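(* Let $H$ be a hereditarily just infinite (discrete or profinite) group that is Fitting-free. Let $c\geq 0$ and let $A$ be a (discrete or profinite, respectively) group of (continuous) automorphisms of $H$ that is virtually class-$c$ nilpotent and satisfies $A\cap\operatorname{Inn}H=1$. Then the semidirect product $H\rtimes A$ of $H$ by $A$ (with respect to the natural action) is hereditarily JNN$_c$F.
   Context: In the discrete case $A$ is any subgroup of $\operatorname{Aut}H$ with the stated properties. In the profinite case $A$ is a subgroup of the group $\operatorname{Aut}_{\mathrm c}H$ of topological automorphisms of $H$ (automorphisms that are homeomorphisms) such that $A$ is a profinite group under the topology induced from $\operatorname{Aut}_{\mathrm c}H$, so that $H\rtimes A$ is a profinite group; here $\operatorname{Aut}_{\mathrm c}H$ carries its usual topology (compact-open topology for maps and inverses), in which automorphisms are close to the identity when they and their inverses act uniformly close to the identity. $\operatorname{Inn}H$ is the group of inner automorphisms. In all definitions below, subgroups are closed in the profinite case. The lower central series is $\gamma_1(G)=G$, $\gamma_{i+1}(G)=[\gamma_i(G),G]$. A group is virtually class-$c$ nilpotent if it has a subgroup $K$ of finite index with $\gamma_{c+1}(K)=1$. A group $G$ is JNN$_c$F if $G$ is not virtually class-$c$ nilpotent but $G/N$ is virtually class-$c$ nilpotent for every non-trivial (closed) normal subgroup $N$ of $G$; it is hereditarily JNN$_c$F if every (closed) subgroup of finite index is JNN$_c$F. A group is just infinite if it is infinite and all quotients by non-trivial (closed) normal subgroups are finite; hereditarily just infinite if every (closed) subgroup of finite index is just infinite. A group is Fitting-free if it has no non-trivial abelian (closed) normal subgroup.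 *)

theory Defs
  imports "HOL-Analysis.Abstract_Topological_Spaces" "HOL-Algebra.Bij" "HOL-Algebra.Generated_Groups"
begin

text \<open>
  Discrete and profinite groups are treated uniformly: a group \<open>G\<close> comes with a topology \<open>T\<close> on its
  carrier, and all subgroups are required to be \<open>T\<close>-closed. For the discrete topology this
  requirement (like every closure taken below) is vacuous.
\<close>

definition discrete_group :: "('a, 'b) monoid_scheme \<Rightarrow> 'a topology \<Rightarrow> bool" where
  "discrete_group G T \<longleftrightarrow> group G \<and> T = discrete_topology (carrier G)"

definition top_group :: "('a, 'b) monoid_scheme \<Rightarrow> 'a topology \<Rightarrow> bool" where
  "top_group G T \<longleftrightarrow> group G \<and> topspace T = carrier G
     \<and> continuous_map (prod_topology T T) T (\<lambda>(x, y). x \<otimes>\<^bsub>G\<^esub> y)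
     \<and> continuous_map T T (\<lambda>x. inv\<^bsub>G\<^esub> x)"

definition totally_disconnected_space :: "'a topology \<Rightarrow> bool" where
  "totally_disconnected_space T \<longleftrightarrow>
     (\<forall>x \<in> topspace T. connected_component_of_set T x = {x})"

definition profinite_group :: "('a, 'b) monoid_scheme \<Rightarrow> 'a topology \<Rightarrow> bool" where
  "profinite_group G T \<longleftrightarrow> top_group G T
     \<and> compact_space T \<and> Hausdorff_space T \<and> totally_disconnected_space T"

definition closed_subgroup :: "'a set \<Rightarrow> ('a, 'b) monoid_scheme \<Rightarrow> 'a topology \<Rightarrow> bool" where
  "closed_subgroup K G T \<longleftrightarrow> subgroup K G \<and> closedin T K"

definition closed_normal :: "'a set \<Rightarrow> ('a, 'b) monoid_scheme \<Rightarrow> 'a topology \<Rightarrow> bool" where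
  "closed_normal N G T \<longleftrightarrow> N \<lhd> G \<and> closedin T N"

definition finite_index :: "'a set \<Rightarrow> ('a, 'b) monoid_scheme \<Rightarrow> bool" where
  "finite_index K G \<longleftrightarrow> finite (rcosets\<^bsub>G\<^esub> K)"

definition quot_topology :: "('a, 'b) monoid_scheme \<Rightarrow> 'a topology \<Rightarrow> 'a set \<Rightarrow> 'a set topology" where
  "quot_topology G T N = topology (\<lambda>U. U \<subseteq> carrier (G Mod N)
     \<and> openin T {x \<in> topspace T. N #>\<^bsub>G\<^esub> x \<in> U})"

lemma openin_quot_topology:
  "openin (quot_topology G T N) U \<longleftrightarrow>
     U \<subseteq> carrier (G Mod N) \<and> openin T {x \<in> topspace T. N #>\<^bsub>G\<^esub> x \<in> U}"
proof -
  have "istopology (\<lambda>U. U \<subseteq> carrier (G Mod N) \<and> openin T {x \<in> topspace T. N #>\<^bsub>G\<^esub> x \<in> U})"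
    (is "istopology ?P")
    unfolding istopology_def
  proof (intro conjI allI impI)
    fix U V assume "?P U" "?P V"
    moreover have "{x \<in> topspace T. N #>\<^bsub>G\<^esub> x \<in> U \<inter> V} =
        {x \<in> topspace T. N #>\<^bsub>G\<^esub> x \<in> U} \<inter> {x \<in> topspace T. N #>\<^bsub>G\<^esub> x \<in> V}" by auto
    ultimately show "U \<inter> V \<subseteq> carrier (G Mod N)"
      "openin T {x \<in> topspace T. N #>\<^bsub>G\<^esub> x \<in> U \<inter> V}" by auto
  next
    fix \<K> assume *: "\<forall>U\<in>\<K>. ?P U"
    have "{x \<in> topspace T. N #>\<^bsub>G\<^esub> x \<in> \<Union>\<K>} =
        (\<Union>U\<in>\<K>. {x \<in> topspace T. N #>\<^bsub>G\<^esub> x \<in> U})" by auto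
    with * show "\<Union>\<K> \<subseteq> carrier (G Mod N)"
      "openin T {x \<in> topspace T. N #>\<^bsub>G\<^esub> x \<in> \<Union>\<K>}" by auto
  qed
  then show ?thesis unfolding quot_topology_def by (simp add: topology_inverse')
qed

text \<open>\<open>lower_central G T i\<close> is \<open>\<gamma>\<^sub>i(G)\<close> for \<open>i \<ge> 1\<close> (the value at \<open>0\<close> is irrelevant). As subgroups
  are closed, \<open>[\<gamma>\<^sub>i(G), G]\<close> is the closure of the subgroup generated by the commutators.\<close>

fun lower_central :: "('a, 'b) monoid_scheme \<Rightarrow> 'a topology \<Rightarrow> nat \<Rightarrow> 'a set" where
  "lower_central G T 0 = carrier G"
| "lower_central G T (Suc 0) = carrier G"
| "lower_central G T (Suc (Suc i)) =
     T closure_of generate G {x \<otimes>\<^bsub>G\<^esub> y \<otimes>\<^bsub>G\<^esub> inv\<^bsub>G\<^esub> x \<otimes>\<^bsub>G\<^esub> inv\<^bsub>G\<^esub> y | x y.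
       x \<in> lower_central G T (Suc i) \<and> y \<in> carrier G}"

definition virtually_nilpotent :: "nat \<Rightarrow> ('a, 'b) monoid_scheme \<Rightarrow> 'a topology \<Rightarrow> bool" where
  "virtually_nilpotent c G T \<longleftrightarrow> (\<exists>K. closed_subgroup K G T \<and> finite_index K G
     \<and> lower_central (G\<lparr>carrier := K\<rparr>) (subtopology T K) (c + 1) = {\<one>\<^bsub>G\<^esub>})"

definition JNNF :: "nat \<Rightarrow> ('a, 'b) monoid_scheme \<Rightarrow> 'a topology \<Rightarrow> bool" where
  "JNNF c G T \<longleftrightarrow> \<not> virtually_nilpotent c G T
     \<and> (\<forall>N. closed_normal N G T \<and> N \<noteq> {\<one>\<^bsub>G\<^esub>} \<longrightarrow>
            virtually_nilpotent c (G Mod N) (quot_topology G T N))"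

definition hereditarily_JNNF :: "nat \<Rightarrow> ('a, 'b) monoid_scheme \<Rightarrow> 'a topology \<Rightarrow> bool" where
  "hereditarily_JNNF c G T \<longleftrightarrow> (\<forall>K. closed_subgroup K G T \<and> finite_index K G \<longrightarrow>
     JNNF c (G\<lparr>carrier := K\<rparr>) (subtopology T K))"

definition just_infinite :: "('a, 'b) monoid_scheme \<Rightarrow> 'a topology \<Rightarrow> bool" where
  "just_infinite G T \<longleftrightarrow> infinite (carrier G)
     \<and> (\<forall>N. closed_normal N G T \<and> N \<noteq> {\<one>\<^bsub>G\<^esub>} \<longrightarrow> finite (carrier (G Mod N)))"

definition hereditarily_just_infinite :: "('a, 'b) monoid_scheme \<Rightarrow> 'a topology \<Rightarrow> bool" where
  "hereditarily_just_infinite G T \<longleftrightarrow> (\<forall>K. closed_subgroup K G T \<and> finite_index K G \<longrightarrow>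
     just_infinite (G\<lparr>carrier := K\<rparr>) (subtopology T K))"

definition Fitting_free :: "('a, 'b) monoid_scheme \<Rightarrow> 'a topology \<Rightarrow> bool" where
  "Fitting_free G T \<longleftrightarrow>
     (\<forall>N. closed_normal N G T \<and> comm_group (G\<lparr>carrier := N\<rparr>) \<longrightarrow> N = {\<one>\<^bsub>G\<^esub>})"

definition Inn :: "('a, 'b) monoid_scheme \<Rightarrow> ('a \<Rightarrow> 'a) set" where
  "Inn G = (\<lambda>g. \<lambda>x \<in> carrier G. g \<otimes>\<^bsub>G\<^esub> x \<otimes>\<^bsub>G\<^esub> inv\<^bsub>G\<^esub> g) ` carrier G"

definition auto_c :: "('a, 'b) monoid_scheme \<Rightarrow> 'a topology \<Rightarrow> ('a \<Rightarrow> 'a) set" where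
  "auto_c G T = {f \<in> auto G. homeomorphic_map T T f}"

definition AutoGroup_c :: "('a, 'b) monoid_scheme \<Rightarrow> 'a topology \<Rightarrow> ('a \<Rightarrow> 'a) monoid" where
  "AutoGroup_c G T = (AutoGroup G)\<lparr>carrier := auto_c G T\<rparr>"

text \<open>The compact-open topology for automorphisms and their inverses.\<close>

definition auto_topology :: "('a, 'b) monoid_scheme \<Rightarrow> 'a topology \<Rightarrow> ('a \<Rightarrow> 'a) topology" where
  "auto_topology G T = topology_generated_by
     ({{f \<in> auto_c G T. f ` C \<subseteq> U} | C U. compactin T C \<and> openin T U} \<union>
      {{f \<in> auto_c G T. inv_into (carrier G) f ` C \<subseteq> U} | C U. compactin T C \<and> openin T U})"

lemma topspace_auto_topology [simp]: "topspace (auto_topology G T) = auto_c G T"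
proof -
  have "auto_c G T = {f \<in> auto_c G T. f ` {} \<subseteq> {}}" by simp
  then have "auto_c G T \<in> {{f \<in> auto_c G T. f ` C \<subseteq> U} | C U. compactin T C \<and> openin T U}"
    using compactin_empty openin_empty by blast
  then show ?thesis
    unfolding auto_topology_def topology_generated_by_topspace by blast
qed

text \<open>The product on \<open>G \<rtimes>\<^sub>\<phi> Q\<close> is \<open>(g, a)(h, b) = (g \<cdot> \<phi>\<^sub>a(h), ab)\<close>.\<close>

definition semidirect_product ::
  "('a, 'b) monoid_scheme \<Rightarrow> ('q, 'd) monoid_scheme \<Rightarrow> ('q \<Rightarrow> 'a \<Rightarrow> 'a) \<Rightarrow> ('a \<times> 'q) monoid" where
  "semidirect_product G Q \<phi> =
     \<lparr>carrier = carrier G \<times> carrier Q,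
      mult = \<lambda>(g, a) (h, b). (g \<otimes>\<^bsub>G\<^esub> \<phi> a h, a \<otimes>\<^bsub>Q\<^esub> b),
      one = (\<one>\<^bsub>G\<^esub>, \<one>\<^bsub>Q\<^esub>)\<rparr>"

lemma group_semidirect_product:
  assumes "group G" "group Q" and hom: "\<phi> \<in> hom Q (AutoGroup G)"
  shows "group (semidirect_product G Q \<phi>)"
proof -
  interpret G: group G by fact
  interpret Q: group Q by fact
  interpret \<phi>: group_hom Q "AutoGroup G" \<phi>
    using assms G.AutoGroup by (simp add: group_hom_def group_hom_axioms_def)
  have aut: "\<phi> a \<in> auto G" if "a \<in> carrier Q" for a
    using \<phi>.hom_closed[OF that] by (simp add: AutoGroup_def)
  have closed: "\<phi> a x \<in> carrier G" if "a \<in> carrier Q" "x \<in> carrier G" for a x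
    using aut[OF that(1)] that(2) by (auto simp: auto_def hom_def)
  have mult: "\<phi> a (x \<otimes>\<^bsub>G\<^esub> y) = \<phi> a x \<otimes>\<^bsub>G\<^esub> \<phi> a y"
    if "a \<in> carrier Q" "x \<in> carrier G" "y \<in> carrier G" for a x y
    using aut[OF that(1)] that(2,3) by (auto simp: auto_def hom_def)
  have comp: "\<phi> (a \<otimes>\<^bsub>Q\<^esub> b) x = \<phi> a (\<phi> b x)"
    if "a \<in> carrier Q" "b \<in> carrier Q" "x \<in> carrier G" for a b x
    using \<phi>.hom_mult[OF that(1,2)] aut[OF that(1)] aut[OF that(2)] that(3)
    by (simp add: AutoGroup_def BijGroup_def auto_def compose_def)
  have one: "\<phi> \<one>\<^bsub>Q\<^esub> x = x" if "x \<in> carrier G" for x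
    using \<phi>.hom_one that by (simp add: AutoGroup_def BijGroup_def)
  show ?thesis
  proof (rule groupI)
    fix x assume "x \<in> carrier (semidirect_product G Q \<phi>)"
    then obtain g a where x: "x = (g, a)" "g \<in> carrier G" "a \<in> carrier Q"
      by (auto simp: semidirect_product_def)
    let ?b = "inv\<^bsub>Q\<^esub> a"
    let ?y = "(\<phi> ?b (inv\<^bsub>G\<^esub> g), ?b)"
    have "?y \<otimes>\<^bsub>semidirect_product G Q \<phi>\<^esub> x = \<one>\<^bsub>semidirect_product G Q \<phi>\<^esub>"
      using x mult[of ?b "inv\<^bsub>G\<^esub> g" g] mult[of ?b "\<one>\<^bsub>G\<^esub>" "\<one>\<^bsub>G\<^esub>"] closed[of ?b "\<one>\<^bsub>G\<^esub>"]
      by (simp add: semidirect_product_def)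
    then show "\<exists>y\<in>carrier (semidirect_product G Q \<phi>).
        y \<otimes>\<^bsub>semidirect_product G Q \<phi>\<^esub> x = \<one>\<^bsub>semidirect_product G Q \<phi>\<^esub>"
      using x closed by (intro bexI[of _ ?y]) (auto simp: semidirect_product_def simp del: \<phi>.hom_inv)
  qed (auto simp: semidirect_product_def closed mult comp one G.m_assoc Q.m_assoc
      simp del: \<phi>.hom_mult \<phi>.hom_one)
qed

end

theory Submission
  imports Defs
begin

text \<open>
  Let \<open>G = H \<rtimes> A\<close> and let \<open>K\<close> be a closed subgroup of finite index. Fitting-freeness forces every
  closed subgroup of finite index in \<open>H\<close> to have trivial centralizer: the core \<open>C\<close> of such a subgroup
  meets its own centralizer in a closed abelian normal subgroup, hence trivially, and a non-trivial
  centralizer of \<open>C\<close> would have finite index. So no closed finite-index subgroup of \<open>H\<close> is nilpotent,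
  and \<open>K\<close> is not virtually nilpotent.

  Let \<open>N\<close> be a non-trivial closed normal subgroup of \<open>K\<close>. If \<open>N \<inter> H = 1\<close>, then \<open>N\<close> centralizes
  \<open>K \<inter> H\<close>; by the above every element of \<open>N\<close> acts trivially on all of \<open>H\<close>, so \<open>A \<inter> Inn H = 1\<close> gives
  \<open>N = 1\<close>. Hence \<open>N \<inter> H \<noteq> 1\<close> has finite index in \<open>K \<inter> H\<close>, and for \<open>B \<le> A\<close> closed, nilpotent and of finite
  index the image of \<open>B \<inter> K\<close> in \<open>K/N\<close> has finite index. Taking the image of a subgroup of \<open>A\<close> itself
  keeps the class \<open>c\<close>, which a centralizer argument in \<open>K/N\<close> would raise by one.
\<close>

section \<open>Subgroups of finite index\<close>

lemma (in group) inv_mult_cancel: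
  assumes "x \<in> carrier G" "y \<in> carrier G"
  shows "inv x \<otimes> (x \<otimes> y) = y" "x \<otimes> (inv x \<otimes> y) = y"
  using assms by (simp_all flip: m_assoc)

text \<open>Each fibre of \<open>f\<close> lies in a single right coset of \<open>K\<close>, so
  there are no more cosets than values of \<open>f\<close>. As \<open>f\<close> may be any map, most
  finiteness claims below reduce to naming finite data that determine a coset.\<close>

lemma finite_indexI:
  assumes "group G" "subgroup K G" "finite (f ` carrier G)"
    and "\<And>x y. x \<in> carrier G \<Longrightarrow> y \<in> carrier G \<Longrightarrow> f x = f y \<Longrightarrow> x \<otimes>\<^bsub>G\<^esub> inv\<^bsub>G\<^esub> y \<in> K"
  shows "finite_index K G"
proof -
  interpret G: group G by fact
  interpret K: subgroup K G by fact
  \<comment> \<open>A value \<open>v\<close> of \<open>f\<close> is sent to the coset of a chosen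
    preimage of \<open>v\<close>; every coset arises in this way.\<close>
  let ?r = "\<lambda>v. K #>\<^bsub>G\<^esub> (SOME x. x \<in> carrier G \<and> f x = v)"
  have "K #>\<^bsub>G\<^esub> x = ?r (f x)" if "x \<in> carrier G" for x
  proof -
    let ?y = "SOME y. y \<in> carrier G \<and> f y = f x"
    have y: "?y \<in> carrier G \<and> f ?y = f x"
      using that by (intro someI[of "\<lambda>y. y \<in> carrier G \<and> f y = f x" x]) auto
    then have "x \<in> K #>\<^bsub>G\<^esub> ?y"
      using assms(4)[of x ?y] that K.rcos_module[OF assms(1), of ?y x] by auto
    then show ?thesis
      using y by (metis G.repr_independence K.subgroup_axioms)
  qed
  then have "rcosets\<^bsub>G\<^esub> K \<subseteq> ?r ` (f ` carrier G)"
    unfolding RCOSETS_def by auto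
  then show ?thesis
    unfolding finite_index_def using assms(3) by (meson finite_imageI finite_subset)
qed

lemma finite_index_finite_image:
  "finite_index K G \<Longrightarrow> finite ((\<lambda>x. K #>\<^bsub>G\<^esub> x) ` carrier G)"
  by (simp add: finite_index_def RCOSETS_def UNION_singleton_eq_range)

lemma rcos_eq_imp_div_mem:
  assumes "group G" "subgroup K G" "x \<in> carrier G" "y \<in> carrier G" "K #>\<^bsub>G\<^esub> x = K #>\<^bsub>G\<^esub> y"
  shows "x \<otimes>\<^bsub>G\<^esub> inv\<^bsub>G\<^esub> y \<in> K"
  using assms by (metis group.rcos_self subgroup.rcos_module_imp)

lemma (in group) finite_index_carrier: "finite_index (carrier G) G"
  by (rule finite_indexI[OF group_axioms subgroup_self, where f = "\<lambda>_. ()"]) auto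

lemma (in group) finite_index_one_imp_finite:
  assumes "finite_index {\<one>} G"
  shows "finite (carrier G)"
proof -
  have "inj_on (\<lambda>x. {\<one>} #> x) (carrier G)"
    by (auto simp: inj_on_def r_coset_def)
  then show ?thesis
    using finite_index_finite_image[OF assms] finite_imageD by blast
qed

text \<open>A coset of \<open>K \<inter> L\<close> is determined by the cosets of \<open>K\<close>
  and of \<open>L\<close> that contain it.\<close>

lemma (in group) finite_index_Int:
  assumes "subgroup K G" "subgroup L G" "finite_index K G" "finite_index L G"
  shows "finite_index (K \<inter> L) G"
proof (rule finite_indexI[OF group_axioms, where f = "\<lambda>x. (K #> x, L #> x)"])
  show "subgroup (K \<inter> L) G" using assms subgroups_Inter_pair by blast
  show "finite ((\<lambda>x. (K #> x, L #> x)) ` carrier G)"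
    by (rule finite_subset[OF _ finite_cartesian_product[OF finite_index_finite_image[OF assms(3)]
          finite_index_finite_image[OF assms(4)]]]) auto
  show "x \<otimes> inv y \<in> K \<inter> L"
    if "x \<in> carrier G" "y \<in> carrier G" "(K #> x, L #> x) = (K #> y, L #> y)" for x y
    using that rcos_eq_imp_div_mem[OF group_axioms] assms by auto
qed

text \<open>Write \<open>x\<close> as an element of \<open>L\<close> times a representative
  \<open>r x\<close> of its \<open>L\<close>-coset, taken from a finite set. The
  \<open>K\<close>-coset of \<open>x\<close> is then determined by \<open>r x\<close> and the
  \<open>K\<close>-coset of the first factor.\<close>

lemma (in group) finite_index_trans:
  assumes "subgroup L G" "subgroup K (G\<lparr>carrier := L\<rparr>)"
    and "finite_index L G" "finite_index K (G\<lparr>carrier := L\<rparr>)"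
  shows "finite_index K G"
proof -
  interpret L: subgroup L G by fact
  interpret L': group "G\<lparr>carrier := L\<rparr>" using assms(1) subgroup_imp_group by blast
  have K: "subgroup K G" using assms(1,2) incl_subgroup by blast
  define r where "r x = (SOME y. y \<in> carrier G \<and> L #> y = L #> x)" for x
  have r: "r x \<in> carrier G \<and> L #> r x = L #> x" if "x \<in> carrier G" for x
    unfolding r_def by (rule someI[of _ x]) (use that in auto)
  have rL: "x \<otimes> inv (r x) \<in> L" if "x \<in> carrier G" for x
    using rcos_eq_imp_div_mem[OF group_axioms assms(1) that, of "r x"] r[OF that] by auto
  have "r ` carrier G \<subseteq> (\<lambda>C. SOME y. y \<in> carrier G \<and> L #> y = C) ` ((\<lambda>x. L #> x) ` carrier G)"
    unfolding r_def by auto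
  then have fr: "finite (r ` carrier G)"
    using finite_index_finite_image[OF assms(3)] finite_subset by blast
  have fK: "finite ((\<lambda>x. K #> x) ` L)"
    using finite_index_finite_image[OF assms(4)] by simp
  show ?thesis
  proof (rule finite_indexI[OF group_axioms K, where f = "\<lambda>x. (r x, K #> (x \<otimes> inv (r x)))"])
    show "finite ((\<lambda>x. (r x, K #> (x \<otimes> inv (r x)))) ` carrier G)"
      by (rule finite_subset[OF _ finite_cartesian_product[OF fr fK]]) (use rL in auto)
    fix x y assume xy: "x \<in> carrier G" "y \<in> carrier G"
      and "(r x, K #> (x \<otimes> inv (r x))) = (r y, K #> (y \<otimes> inv (r y)))"
    then have e: "r y = r x" "K #> (x \<otimes> inv (r x)) = K #> (y \<otimes> inv (r y))"
      by (metis prod.inject)+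
    have rx: "r x \<in> carrier G" using r xy by blast
    have "(x \<otimes> inv (r x)) \<otimes> inv (y \<otimes> inv (r y)) \<in> K"
      by (rule rcos_eq_imp_div_mem[OF group_axioms K _ _ e(2)]) (use e(1) xy rx in simp_all)
    moreover have "(x \<otimes> inv (r x)) \<otimes> inv (y \<otimes> inv (r y)) = x \<otimes> inv y"
      unfolding e(1) using xy rx by (simp add: inv_mult_group m_assoc inv_mult_cancel)
    ultimately show "x \<otimes> inv y \<in> K" by simp
  qed
qed

lemma (in group_hom) subgroup_preimage:
  assumes "subgroup K H"
  shows "subgroup {x \<in> carrier G. h x \<in> K} G"
  by (rule G.subgroupI)
    (use assms in \<open>auto simp: subgroup.one_closed subgroup.m_closed subgroup.m_inv_closed
      intro!: exI[of _ "\<one>"]\<close>)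

lemma (in group_hom) finite_index_preimage:
  assumes "subgroup K H" "finite_index K H"
  shows "finite_index {x \<in> carrier G. h x \<in> K} G"
proof (rule finite_indexI[OF G.group_axioms subgroup_preimage[OF assms(1)],
      where f = "\<lambda>x. K #>\<^bsub>H\<^esub> h x"])
  show "finite ((\<lambda>x. K #>\<^bsub>H\<^esub> h x) ` carrier G)"
    by (rule finite_subset[OF _ finite_index_finite_image[OF assms(2)]]) auto
  show "x \<otimes> inv y \<in> {x \<in> carrier G. h x \<in> K}"
    if "x \<in> carrier G" "y \<in> carrier G" "K #>\<^bsub>H\<^esub> h x = K #>\<^bsub>H\<^esub> h y" for x y
    using that rcos_eq_imp_div_mem[OF H.group_axioms assms(1), of "h x" "h y"] by simp
qed

text \<open>Cosets are compared through a set-theoretic section \<open>s\<close> of the surjection: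
  if \<open>s x\<close> and \<open>s y\<close> lie in one coset of the preimage, then
  \<open>x\<close> and \<open>y\<close> lie in one coset of \<open>K\<close>.\<close>

lemma (in group_hom) finite_index_image:
  assumes "h ` carrier G = carrier H" "subgroup K H"
    and "finite_index {x \<in> carrier G. h x \<in> K} G"
  shows "finite_index K H"
proof -
  let ?P = "{x \<in> carrier G. h x \<in> K}"
  define s where "s = inv_into (carrier G) h"
  have s: "s y \<in> carrier G" "h (s y) = y" if "y \<in> carrier H" for y
    using that assms(1) inv_into_into[of y h] f_inv_into_f[of y h] by (auto simp: s_def)
  show ?thesis
  proof (rule finite_indexI[OF H.group_axioms assms(2), where f = "\<lambda>y. ?P #> s y"])
    show "finite ((\<lambda>y. ?P #> s y) ` carrier H)"
      by (rule finite_subset[OF _ finite_index_finite_image[OF assms(3)]]) (use s in auto)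
    show "x \<otimes>\<^bsub>H\<^esub> inv\<^bsub>H\<^esub> y \<in> K"
      if "x \<in> carrier H" "y \<in> carrier H" "?P #> s x = ?P #> s y" for x y
      using rcos_eq_imp_div_mem[OF G.group_axioms subgroup_preimage[OF assms(2)] _ _ that(3)]
        s that(1,2) by auto
  qed
qed

section \<open>Normal cores\<close>

text \<open>For a subgroup \<open>K\<close> this is the intersection of its conjugates, the largest
  normal subgroup inside \<open>K\<close>. The elementwise form exhibits it as an intersection of
  preimages of \<open>K\<close> under conjugations, from which closedness is read off later.\<close>

definition normal_core :: "('a, 'b) monoid_scheme \<Rightarrow> 'a set \<Rightarrow> 'a set" where
  "normal_core G K = {g \<in> carrier G. \<forall>x\<in>carrier G. x \<otimes>\<^bsub>G\<^esub> g \<otimes>\<^bsub>G\<^esub> inv\<^bsub>G\<^esub> x \<in> K}"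

context group begin

lemma normal_core_subset: "K \<subseteq> carrier G \<Longrightarrow> normal_core G K \<subseteq> K"
  unfolding normal_core_def by (force dest: bspec[of _ _ \<one>])

lemma normal_normal_core:
  assumes "subgroup K G"
  shows "normal_core G K \<lhd> G"
proof (rule normal_invI)
  interpret K: subgroup K G by fact
  show "subgroup (normal_core G K) G"
  proof (rule subgroupI)
    show "normal_core G K \<noteq> {}"
      by (auto simp: normal_core_def intro!: exI[of _ \<one>])
  next
    fix a assume a: "a \<in> normal_core G K"
    have "x \<otimes> inv a \<otimes> inv x \<in> K" if "x \<in> carrier G" for x
    proof -
      have "inv (x \<otimes> a \<otimes> inv x) \<in> K" using a that by (auto simp: normal_core_def)
      moreover have "inv (x \<otimes> a \<otimes> inv x) = x \<otimes> inv a \<otimes> inv x"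
        using a that by (simp add: normal_core_def inv_mult_group m_assoc)
      ultimately show ?thesis by simp
    qed
    then show "inv a \<in> normal_core G K" using a by (auto simp: normal_core_def)
  next
    fix a b assume ab: "a \<in> normal_core G K" "b \<in> normal_core G K"
    have "x \<otimes> (a \<otimes> b) \<otimes> inv x \<in> K" if "x \<in> carrier G" for x
    proof -
      have "(x \<otimes> a \<otimes> inv x) \<otimes> (x \<otimes> b \<otimes> inv x) \<in> K"
        using ab that by (auto simp: normal_core_def)
      moreover have "(x \<otimes> a \<otimes> inv x) \<otimes> (x \<otimes> b \<otimes> inv x) = x \<otimes> (a \<otimes> b) \<otimes> inv x"
        using ab that by (simp add: normal_core_def m_assoc inv_mult_cancel)
      ultimately show ?thesis by simp
    qed
    then show "a \<otimes> b \<in> normal_core G K" using ab by (auto simp: normal_core_def)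
  qed (auto simp: normal_core_def)
next
  fix x h assume xh: "x \<in> carrier G" "h \<in> normal_core G K"
  have "y \<otimes> (x \<otimes> h \<otimes> inv x) \<otimes> inv y \<in> K" if "y \<in> carrier G" for y
  proof -
    have "(y \<otimes> x) \<otimes> h \<otimes> inv (y \<otimes> x) \<in> K" using xh that by (auto simp: normal_core_def)
    then show ?thesis using xh that by (simp add: normal_core_def m_assoc inv_mult_group)
  qed
  then show "x \<otimes> h \<otimes> inv x \<in> normal_core G K" using xh by (auto simp: normal_core_def)
qed

text \<open>The group acts on the finite set of cosets of \<open>K\<close>, and elements inducing the same permutation
  agree modulo the core.\<close>

lemma finite_index_normal_core:
  assumes "subgroup K G" "finite_index K G"
  shows "finite_index (normal_core G K) G"
proof (rule finite_indexI[OF group_axioms, where f = "\<lambda>g. \<lambda>C\<in>rcosets K. C #> g"])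
  interpret K: subgroup K G by fact
  show "subgroup (normal_core G K) G"
    using normal_normal_core[OF assms(1)] normal_imp_subgroup by blast
  have "(\<lambda>C\<in>rcosets K. C #> g) \<in> (rcosets K) \<rightarrow>\<^sub>E (rcosets K)" if "g \<in> carrier G" for g
    using that by (auto simp: RCOSETS_def coset_mult_assoc K.subset)
  moreover have "finite ((rcosets K) \<rightarrow>\<^sub>E (rcosets K))"
    using assms(2) by (simp add: finite_PiE finite_index_def)
  ultimately show "finite ((\<lambda>g. \<lambda>C\<in>rcosets K. C #> g) ` carrier G)"
    by (meson finite_subset image_subsetI)
  fix a b assume ab: "a \<in> carrier G" "b \<in> carrier G"
    and eq: "(\<lambda>C\<in>rcosets K. C #> a) = (\<lambda>C\<in>rcosets K. C #> b)"
  have "x \<otimes> (a \<otimes> inv b) \<otimes> inv x \<in> K" if x: "x \<in> carrier G" for x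
  proof -
    have "K #> x \<in> rcosets K" using x by (simp add: rcosetsI K.subset)
    \<comment> \<open>Comparing the two permutations at the coset of \<open>x\<close> yields the
      condition on the conjugate by \<open>x\<close>.\<close>
    then have "K #> x #> a = K #> x #> b" using fun_cong[OF eq, of "K #> x"] by simp
    then have "K #> (x \<otimes> a) = K #> (x \<otimes> b)" using ab x by (simp add: coset_mult_assoc K.subset)
    then have "(x \<otimes> a) \<otimes> inv (x \<otimes> b) \<in> K"
      using rcos_eq_imp_div_mem[OF group_axioms assms(1)] ab x by simp
    then show ?thesis using ab x by (simp add: m_assoc inv_mult_group)
  qed
  then show "a \<otimes> inv b \<in> normal_core G K" using ab by (auto simp: normal_core_def)
qed

end

section \<open>Lower central series\<close>

text \<open>The generators of the term with index \<open>i + 2\<close>. Naming them lets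
  commutators, generation and closure be handled as three separate steps.\<close>

definition commutator_set :: "('a, 'b) monoid_scheme \<Rightarrow> 'a topology \<Rightarrow> nat \<Rightarrow> 'a set" where
  "commutator_set G T i = {x \<otimes>\<^bsub>G\<^esub> y \<otimes>\<^bsub>G\<^esub> inv\<^bsub>G\<^esub> x \<otimes>\<^bsub>G\<^esub> inv\<^bsub>G\<^esub> y | x y.
       x \<in> lower_central G T (Suc i) \<and> y \<in> carrier G}"

lemma lower_central_Suc_Suc:
  "lower_central G T (Suc (Suc i)) = T closure_of generate G (commutator_set G T i)"
  by (simp add: commutator_set_def)

lemma lower_central_closed:
  assumes "topspace T = carrier G"
  shows "closedin T (lower_central G T i)"
proof -
  have "closedin T (carrier G)" using closedin_topspace[of T] assms by simp
  then show ?thesis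
  proof (cases "i \<le> 1")
    case True
    then have "lower_central G T i = carrier G" by (cases i) auto
    with \<open>closedin T (carrier G)\<close> show ?thesis by simp
  next
    case False
    then obtain j where "i = Suc (Suc j)" by (cases i rule: nat.exhaust; cases "i - 1") auto
    then show ?thesis by (simp only: lower_central_Suc_Suc closedin_closure_of)
  qed
qed

lemma lower_central_subset:
  assumes "topspace T = carrier G"
  shows "lower_central G T i \<subseteq> carrier G"
  using lower_central_closed[OF assms] closedin_subset assms by metis

lemma commutator_set_subset:
  assumes "group G" "topspace T = carrier G"
  shows "commutator_set G T i \<subseteq> carrier G"
proof -
  interpret group G by fact
  show ?thesis
    using lower_central_subset[OF assms(2), of "Suc i"] by (auto simp: commutator_set_def)
qed

lemma generate_subset_lower_central:
  assumes "group G" "topspace T = carrier G"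
  shows "generate G (commutator_set G T i) \<subseteq> lower_central G T (Suc (Suc i))"
  unfolding lower_central_Suc_Suc
  using group.generate_incl[OF assms(1) commutator_set_subset[OF assms]] assms(2)
  by (simp add: closure_of_subset)

lemma one_mem_lower_central:
  assumes "group G" "topspace T = carrier G"
  shows "\<one>\<^bsub>G\<^esub> \<in> lower_central G T i"
proof (cases "i \<le> 1")
  case True
  then have "lower_central G T i = carrier G" by (cases i) auto
  then show ?thesis using assms(1) by (simp add: group.is_monoid monoid.one_closed)
next
  case False
  then obtain j where "i = Suc (Suc j)" by (cases i rule: nat.exhaust; cases "i - 1") auto
  then show ?thesis
    using generate_subset_lower_central[OF assms, of j] generate.one[of G] by blast
qed

text \<open>Commutators go to commutators and generated subgroups to generated subgroups; continuity
  then sends closures into closures.\<close>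

lemma lower_central_image_subset:
  assumes "group_hom G G' h" "topspace T = carrier G" "topspace T' = carrier G'"
    and "continuous_map T T' h"
  shows "h ` lower_central G T i \<subseteq> lower_central G' T' i"
proof -
  interpret group_hom G G' h by fact
  have *: "h ` lower_central G T (Suc i) \<subseteq> lower_central G' T' (Suc i)" for i
  proof (induction i)
    case 0
    then show ?case by auto
  next
    case (Suc i)
    have "h ` commutator_set G T i \<subseteq> commutator_set G' T' i"
      using Suc lower_central_subset[OF assms(2), of "Suc i"]
      by (fastforce simp: commutator_set_def subset_iff)
    then have "h ` generate G (commutator_set G T i) \<subseteq> generate G' (commutator_set G' T' i)"
      using generate_img[OF commutator_set_subset[OF G.group_axioms assms(2)]] H.mono_generate
      by metis
    then show ?case
      unfolding lower_central_Suc_Suc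
      using continuous_map_image_closure_subset[OF assms(4)] closure_of_mono by (metis (no_types) order_trans)
  qed
  \<comment> \<open>The induction starts at index 1. Index 0 follows because the series has the same
    value there as at index 1.\<close>
  show ?thesis
    using *[of "i - 1"] by (cases i) auto
qed

text \<open>The opposite inclusion rests on a closed map: the image of a term of the series of
  \<open>G\<close> is closed and contains the generators of the corresponding term for
  \<open>G'\<close>, hence also their closure.\<close>

lemma lower_central_subset_image:
  assumes "group_hom G G' h" "topspace T = carrier G" "topspace T' = carrier G'"
    and surj: "h ` carrier G = carrier G'"
    and closed: "\<And>X. closedin T X \<Longrightarrow> closedin T' (h ` X)"
  shows "lower_central G' T' i \<subseteq> h ` lower_central G T i"
proof -
  interpret group_hom G G' h by fact
  have *: "lower_central G' T' (Suc i) \<subseteq> h ` lower_central G T (Suc i)" for i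
  proof (induction i)
    case 0
    then show ?case using surj by auto
  next
    case (Suc i)
    have "commutator_set G' T' i \<subseteq> h ` commutator_set G T i"
    proof
      fix z assume "z \<in> commutator_set G' T' i"
      then obtain x' y' where "x' \<in> lower_central G' T' (Suc i)" "y' \<in> carrier G'"
        and z': "z = x' \<otimes>\<^bsub>G'\<^esub> y' \<otimes>\<^bsub>G'\<^esub> inv\<^bsub>G'\<^esub> x' \<otimes>\<^bsub>G'\<^esub> inv\<^bsub>G'\<^esub> y'"
        unfolding commutator_set_def by blast
      moreover obtain x where "x \<in> lower_central G T (Suc i)" "x' = h x"
        using Suc \<open>x' \<in> _\<close> by blast
      moreover obtain y where "y \<in> carrier G" "y' = h y"
        using surj \<open>y' \<in> _\<close> by blast
      ultimately have xy: "x \<in> lower_central G T (Suc i)" "y \<in> carrier G"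
        and z: "z = h x \<otimes>\<^bsub>G'\<^esub> h y \<otimes>\<^bsub>G'\<^esub> inv\<^bsub>G'\<^esub> (h x) \<otimes>\<^bsub>G'\<^esub> inv\<^bsub>G'\<^esub> (h y)"
        by simp_all
      then have "z = h (x \<otimes>\<^bsub>G\<^esub> y \<otimes>\<^bsub>G\<^esub> inv\<^bsub>G\<^esub> x \<otimes>\<^bsub>G\<^esub> inv\<^bsub>G\<^esub> y)"
        using lower_central_subset[OF assms(2), of "Suc i"] by (auto simp: subset_iff)
      then show "z \<in> h ` commutator_set G T i"
        using xy unfolding commutator_set_def by blast
    qed
    then have "generate G' (commutator_set G' T' i) \<subseteq> h ` generate G (commutator_set G T i)"
      using generate_img[OF commutator_set_subset[OF G.group_axioms assms(2)]] H.mono_generate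
      by metis
    also have "\<dots> \<subseteq> h ` lower_central G T (Suc (Suc i))"
      using generate_subset_lower_central[OF G.group_axioms assms(2)] by blast
    finally show ?case
      unfolding lower_central_Suc_Suc[of G']
      by (rule closure_of_minimal) (intro closed lower_central_closed assms)
  qed
  show ?thesis
    using *[of "i - 1"] surj by (cases i) auto
qed

text \<open>The last non-trivial term of the lower central series is central.\<close>

lemma lower_central_trivial_imp_central:
  assumes "group G" "topspace T = carrier G" "lower_central G T (Suc c) = {\<one>\<^bsub>G\<^esub>}"
    and "carrier G \<noteq> {\<one>\<^bsub>G\<^esub>}"
  obtains z where "z \<in> carrier G" "z \<noteq> \<one>\<^bsub>G\<^esub>" "\<And>y. y \<in> carrier G \<Longrightarrow> z \<otimes>\<^bsub>G\<^esub> y = y \<otimes>\<^bsub>G\<^esub> z"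
proof -
  interpret group G by fact
  define i where "i = (LEAST i. lower_central G T (Suc i) = {\<one>\<^bsub>G\<^esub>})"
  have i: "lower_central G T (Suc i) = {\<one>\<^bsub>G\<^esub>}"
    unfolding i_def using assms(3) by (rule LeastI)
  \<comment> \<open>The term at index 1 is the whole group, which is non-trivial, so
    \<open>i\<close> is a successor and the term at \<open>Suc j\<close> is the last non-trivial
    one.\<close>
  obtain j where j: "i = Suc j" using i assms(4) by (cases i) auto
  have "lower_central G T (Suc j) \<noteq> {\<one>\<^bsub>G\<^esub>}"
    using not_less_Least[of j "\<lambda>i. lower_central G T (Suc i) = {\<one>\<^bsub>G\<^esub>}"] j by (simp add: i_def)
  then obtain z where z: "z \<in> lower_central G T (Suc j)" "z \<noteq> \<one>\<^bsub>G\<^esub>"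
    using one_mem_lower_central[OF assms(1,2), of "Suc j"] by blast
  have zc: "z \<in> carrier G" using z lower_central_subset[OF assms(2)] by blast
  have "z \<otimes>\<^bsub>G\<^esub> y = y \<otimes>\<^bsub>G\<^esub> z" if y: "y \<in> carrier G" for y
  proof -
    have "z \<otimes>\<^bsub>G\<^esub> y \<otimes>\<^bsub>G\<^esub> inv\<^bsub>G\<^esub> z \<otimes>\<^bsub>G\<^esub> inv\<^bsub>G\<^esub> y \<in> commutator_set G T j"
      using z(1) y unfolding commutator_set_def by blast
    then have "z \<otimes>\<^bsub>G\<^esub> y \<otimes>\<^bsub>G\<^esub> inv\<^bsub>G\<^esub> z \<otimes>\<^bsub>G\<^esub> inv\<^bsub>G\<^esub> y \<in> lower_central G T (Suc i)"
      using generate_subset_lower_central[OF assms(1,2), of j] generate.incl j by fastforce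
    then have "(z \<otimes>\<^bsub>G\<^esub> y) \<otimes>\<^bsub>G\<^esub> inv\<^bsub>G\<^esub> (y \<otimes>\<^bsub>G\<^esub> z) = \<one>\<^bsub>G\<^esub>" using i zc y by (simp add: inv_mult_group m_assoc)
    then show ?thesis using zc y by (metis inv_equality inv_inv m_closed inv_closed)
  qed
  then show ?thesis using that z(2) zc by blast
qed

section \<open>Hausdorff groups\<close>

text \<open>The topological input shared by discrete and profinite groups: it makes centralizers
  closed and keeps normal cores of closed subgroups closed.\<close>

locale hausdorff_group = group G for G (structure) +
  fixes T
  assumes topspace_eq: "topspace T = carrier G"
    and Hausdorff: "Hausdorff_space T"
    and continuous_mult: "continuous_map (prod_topology T T) T (\<lambda>(x, y). x \<otimes> y)"
begin

lemma continuous_map_mult: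
  assumes "continuous_map X T f" "continuous_map X T g"
  shows "continuous_map X T (\<lambda>x. f x \<otimes> g x)"
  using continuous_map_compose[OF continuous_map_pairedI[OF assms] continuous_mult]
  by (simp add: o_def)

lemma continuous_map_const_carrier: "x \<in> carrier G \<Longrightarrow> continuous_map X T (\<lambda>_. x)"
  by (simp add: topspace_eq)

lemma closedin_normal_core:
  assumes "closedin T K"
  shows "closedin T (normal_core G K)"
proof -
  have "closedin T {g \<in> topspace T. x \<otimes> g \<otimes> inv x \<in> K}" if "x \<in> carrier G" for x
    by (rule closedin_continuous_map_preimage[OF _ assms])
      (intro continuous_map_mult continuous_map_const_carrier continuous_map_id[unfolded id_def]
        inv_closed that)
  then have "closedin T (\<Inter>x\<in>carrier G. {g \<in> topspace T. x \<otimes> g \<otimes> inv x \<in> K})"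
    using one_closed by (intro closedin_INT) auto
  also have "(\<Inter>x\<in>carrier G. {g \<in> topspace T. x \<otimes> g \<otimes> inv x \<in> K}) = normal_core G K"
    using one_closed by (auto simp: normal_core_def topspace_eq)
  finally show ?thesis .
qed

section \<open>Centralizers\<close>

definition centralizer :: "'a set \<Rightarrow> 'a set" where
  "centralizer M = {x \<in> carrier G. \<forall>y\<in>M. x \<otimes> y = y \<otimes> x}"

lemma centralizer_memD:
  "x \<in> centralizer M \<Longrightarrow> y \<in> M \<Longrightarrow> x \<otimes> y = y \<otimes> x"
  by (simp add: centralizer_def)

text \<open>For each \<open>y\<close>, the elements commuting with \<open>y\<close> form the
  equalizer of two continuous maps into a Hausdorff space.\<close>

lemma closedin_centralizer:
  assumes "M \<subseteq> carrier G"
  shows "closedin T (centralizer M)"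
proof (cases "M = {}")
  \<comment> \<open>The intersection used in the other case runs over \<open>M\<close>; over an
    empty index set it would be the whole type instead of \<open>topspace T\<close>.\<close>
  case True
  then show ?thesis by (simp add: centralizer_def flip: topspace_eq)
next
  case False
  have "closedin T {x \<in> topspace T. x \<otimes> y = y \<otimes> x}" if "y \<in> M" for y
    by (rule closedin_continuous_maps_eq[OF Hausdorff])
      (use that assms in \<open>auto intro!: continuous_map_mult continuous_map_const_carrier
        simp del: continuous_map_const\<close>)
  then have "closedin T (\<Inter>y\<in>M. {x \<in> topspace T. x \<otimes> y = y \<otimes> x})"
    using False by (intro closedin_INT) auto
  also have "(\<Inter>y\<in>M. {x \<in> topspace T. x \<otimes> y = y \<otimes> x}) = centralizer M"
    using False by (auto simp: centralizer_def topspace_eq)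
  finally show ?thesis .
qed

lemma normal_centralizer:
  assumes "M \<lhd> G"
  shows "centralizer M \<lhd> G"
proof (rule normal_invI)
  interpret M: normal M G by fact
  show "subgroup (centralizer M) G"
  proof (rule subgroupI)
    show "centralizer M \<noteq> {}"
      by (auto simp: centralizer_def intro!: exI[of _ \<one>])
  next
    fix a assume a: "a \<in> centralizer M"
    have "inv a \<otimes> y = y \<otimes> inv a" if "y \<in> M" for y
    proof -
      have "a \<otimes> y = y \<otimes> a" "a \<in> carrier G" "y \<in> carrier G" using a that by (auto simp: centralizer_def)
      then show ?thesis by (metis inv_closed inv_solve_left' inv_solve_right m_assoc m_closed)
    qed
    then show "inv a \<in> centralizer M" using a by (auto simp: centralizer_def)
  next
    fix a b assume ab: "a \<in> centralizer M" "b \<in> centralizer M"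
    have "a \<otimes> b \<otimes> y = y \<otimes> (a \<otimes> b)" if "y \<in> M" for y
    proof -
      have "a \<otimes> y = y \<otimes> a" "b \<otimes> y = y \<otimes> b" "a \<in> carrier G" "b \<in> carrier G" "y \<in> carrier G"
        using ab that by (auto simp: centralizer_def)
      then show ?thesis by (metis m_assoc)
    qed
    then show "a \<otimes> b \<in> centralizer M" using ab by (auto simp: centralizer_def)
  qed (auto simp: centralizer_def)
  fix x h assume xh: "x \<in> carrier G" "h \<in> centralizer M"
  then have h: "h \<in> carrier G" by (simp add: centralizer_def)
  have "x \<otimes> h \<otimes> inv x \<otimes> y = y \<otimes> (x \<otimes> h \<otimes> inv x)" if y: "y \<in> M" for y
  proof -
    \<comment> \<open>A conjugate of \<open>h\<close> commutes with \<open>y\<close> because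
      \<open>h\<close> commutes with the inverse conjugate \<open>z\<close> of \<open>y\<close>,
      which stays in \<open>M\<close> by normality.\<close>
    define z where "z = inv x \<otimes> y \<otimes> x"
    have z: "z \<in> M" unfolding z_def using M.inv_op_closed1 xh(1) y by blast
    have zc: "z \<in> carrier G" and yc: "y \<in> carrier G" using z y by auto
    have yz: "y = x \<otimes> z \<otimes> inv x"
      unfolding z_def using xh(1) yc by (simp add: m_assoc inv_mult_cancel)
    have "x \<otimes> h \<otimes> inv x \<otimes> y = x \<otimes> (h \<otimes> z) \<otimes> inv x"
      unfolding yz using xh(1) h zc by (simp add: m_assoc inv_mult_cancel)
    also have "h \<otimes> z = z \<otimes> h" using centralizer_memD[OF xh(2) z] .
    also have "x \<otimes> (z \<otimes> h) \<otimes> inv x = y \<otimes> (x \<otimes> h \<otimes> inv x)"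
      unfolding yz using xh(1) h zc by (simp add: m_assoc inv_mult_cancel)
    finally show ?thesis .
  qed
  then show "x \<otimes> h \<otimes> inv x \<in> centralizer M" using xh h by (auto simp: centralizer_def)
qed

lemma centralizer_finite_index_trivial:
  assumes "just_infinite G T" "Fitting_free G T"
    and "closed_subgroup M G T" "finite_index M G"
  shows "centralizer M = {\<one>}"
proof -
  let ?C = "normal_core G M"
  let ?D = "centralizer ?C"
  have M: "subgroup M G" "closedin T M" using assms(3) by (auto simp: closed_subgroup_def)
  have C: "?C \<lhd> G" "closedin T ?C" "finite_index ?C G"
    using normal_normal_core[OF M(1)] closedin_normal_core[OF M(2)]
      finite_index_normal_core[OF M(1) assms(4)] by auto
  have D: "?D \<lhd> G" "closedin T ?D"
    using normal_centralizer[OF C(1)] closedin_centralizer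
    by (auto simp: normal_core_def)
  have sub: "subgroup ?C G" "subgroup ?D G" using C(1) D(1) normal_imp_subgroup by blast+
  have CD: "?C \<inter> ?D \<lhd> G" using C(1) D(1) by (rule normal_subgroup_intersect)
  \<comment> \<open>Of any two elements, one is taken as a member of the core and the other as a
    member of its centralizer. Fitting-freeness then applies to the intersection.\<close>
  have "comm_group (G\<lparr>carrier := ?C \<inter> ?D\<rparr>)"
  proof (rule group.group_comm_groupI)
    show "group (G\<lparr>carrier := ?C \<inter> ?D\<rparr>)"
      using CD normal_imp_subgroup subgroup_imp_group by blast
  qed (simp, metis IntD1 IntD2 centralizer_memD)
  moreover have "closed_normal (?C \<inter> ?D) G T"
    using CD C(2) D(2) by (simp add: closed_normal_def closedin_Int)
  ultimately have triv: "?C \<inter> ?D = {\<one>}"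
    using assms(2) unfolding Fitting_free_def by metis
  \<comment> \<open>Otherwise \<open>?D\<close> has finite index by just infiniteness, and so has
    its trivial intersection with \<open>?C\<close>; the group would be finite.\<close>
  have "?D = {\<one>}"
  proof (rule ccontr)
    assume "?D \<noteq> {\<one>}"
    moreover have "closed_normal ?D G T" using D by (simp add: closed_normal_def)
    ultimately have "finite (carrier (G Mod ?D))"
      using assms(1) unfolding just_infinite_def by metis
    then have "finite_index ?D G" by (simp add: finite_index_def FactGroup_def)
    then have "finite_index {\<one>} G" using finite_index_Int[OF sub C(3)] triv by simp
    then show False using finite_index_one_imp_finite assms(1) by (simp add: just_infinite_def)
  qed
  \<comment> \<open>Passing from \<open>M\<close> to the smaller set \<open>?C\<close> enlarges the
    centralizer.\<close>
  moreover have "centralizer M \<subseteq> ?D"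
    using normal_core_subset[OF subgroup.subset[OF M(1)]] by (auto simp: centralizer_def)
  moreover have "\<one> \<in> centralizer M"
    using subgroup.subset[OF M(1)] by (auto simp: centralizer_def)
  ultimately show ?thesis by blast
qed

end

section \<open>The semidirect product\<close>

lemma group_hom_restrict:
  assumes "group_hom G G' h" "subgroup K G" "subgroup L G'" "h ` K \<subseteq> L"
  shows "group_hom (G\<lparr>carrier := K\<rparr>) (G'\<lparr>carrier := L\<rparr>) h"
proof -
  interpret group_hom G G' h by fact
  have "K \<subseteq> carrier G" using assms(2) by (rule subgroup.subset)
  then have "h \<in> hom (G\<lparr>carrier := K\<rparr>) (G'\<lparr>carrier := L\<rparr>)"
    using assms(4) by (auto simp: hom_def subset_iff)
  then show ?thesis
    using G.subgroup_imp_group[OF assms(2)] H.subgroup_imp_group[OF assms(3)]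
    by (simp add: group_hom_def group_hom_axioms_def)
qed

lemma closed_subgroup_trans:
  assumes "group G" "closed_subgroup K G T" "closed_subgroup L (G\<lparr>carrier := K\<rparr>) (subtopology T K)"
  shows "closed_subgroup L G T"
  using assms group.incl_subgroup[of G K L] closedin_closed_subtopology[of T K L]
  by (auto simp: closed_subgroup_def)

text \<open>Complements commute with preimages under the coset map, once the whole quotient is known
  to be the underlying space.\<close>

lemma closedin_quot_topology:
  assumes "topspace T = carrier G"
  shows "closedin (quot_topology G T N) C \<longleftrightarrow>
    C \<subseteq> carrier (G Mod N) \<and> closedin T {x \<in> topspace T. N #>\<^bsub>G\<^esub> x \<in> C}"
proof -
  have mem: "N #>\<^bsub>G\<^esub> x \<in> carrier (G Mod N)" if "x \<in> topspace T" for x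
    using that assms by (simp add: carrier_FactGroup)
  have "{x \<in> topspace T. N #>\<^bsub>G\<^esub> x \<in> carrier (G Mod N)} = topspace T" using mem by blast
  then have top: "topspace (quot_topology G T N) = carrier (G Mod N)"
    unfolding topspace_def openin_quot_topology
    by (intro equalityI Sup_least Sup_upper) (auto simp flip: topspace_def)
  have "{x \<in> topspace T. N #>\<^bsub>G\<^esub> x \<in> carrier (G Mod N) - C} =
      topspace T - {x \<in> topspace T. N #>\<^bsub>G\<^esub> x \<in> C}"
    using mem by blast
  then show ?thesis
    by (simp add: closedin_def top openin_quot_topology)
qed

text \<open>
  The closure condition on translates expresses, uniformly for discrete and compact groups, that
  products of closed subsets are closed; as the right factor lies in \<open>1 \<times> Q\<close>, continuity of the
  action of \<open>Q\<close> on \<open>H\<close> is not involved.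
\<close>

locale semidirect =
  H: hausdorff_group H T + Q: group Q
  for H :: "('a, 'b) monoid_scheme" and T and Q :: "('q, 'd) monoid_scheme" +
  fixes S :: "'q topology" and \<phi> :: "'q \<Rightarrow> 'a \<Rightarrow> 'a"
  assumes topspace_S: "topspace S = carrier Q"
    and hom: "\<phi> \<in> hom Q (AutoGroup H)"
    and closedin_translates: "closedin (prod_topology T S) N \<Longrightarrow> closedin S Z \<Longrightarrow>
      closedin (prod_topology T S) ((\<lambda>((g, a), b). (g, a \<otimes>\<^bsub>Q\<^esub> b)) ` (N \<times> Z))"
    and outer: "a \<in> carrier Q \<Longrightarrow> h \<in> carrier H \<Longrightarrow>
      (\<And>x. x \<in> carrier H \<Longrightarrow> h \<otimes>\<^bsub>H\<^esub> \<phi> a x \<otimes>\<^bsub>H\<^esub> inv\<^bsub>H\<^esub> h = x) \<Longrightarrow> a = \<one>\<^bsub>Q\<^esub>"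
    and hereditarily_just_infinite: "hereditarily_just_infinite H T"
    and Fitting_free: "Fitting_free H T"
begin

abbreviation "G \<equiv> semidirect_product H Q \<phi>"
abbreviation "P \<equiv> prod_topology T S"

sublocale G: group G
  using group_semidirect_product[OF H.group_axioms Q.group_axioms hom] .

lemma carrier_G [simp]: "carrier G = carrier H \<times> carrier Q"
  and mult_G [simp]: "(g, a) \<otimes>\<^bsub>G\<^esub> (h, b) = (g \<otimes>\<^bsub>H\<^esub> \<phi> a h, a \<otimes>\<^bsub>Q\<^esub> b)"
  and one_G [simp]: "\<one>\<^bsub>G\<^esub> = (\<one>\<^bsub>H\<^esub>, \<one>\<^bsub>Q\<^esub>)"
  by (simp_all add: semidirect_product_def)

lemma topspace_P: "topspace P = carrier G"
  by (simp add: H.topspace_eq topspace_S)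

lemma
  assumes "a \<in> carrier Q" "x \<in> carrier H"
  shows act_closed: "\<phi> a x \<in> carrier H"
    and act_mult: "y \<in> carrier H \<Longrightarrow> \<phi> a (x \<otimes>\<^bsub>H\<^esub> y) = \<phi> a x \<otimes>\<^bsub>H\<^esub> \<phi> a y"
proof -
  have "\<phi> a \<in> hom H H"
    using hom assms(1) by (auto simp: hom_def[of Q] AutoGroup_def auto_def)
  then show "\<phi> a x \<in> carrier H" "y \<in> carrier H \<Longrightarrow> \<phi> a (x \<otimes>\<^bsub>H\<^esub> y) = \<phi> a x \<otimes>\<^bsub>H\<^esub> \<phi> a y"
    using assms(2) by (auto simp: hom_def)
qed

lemma act_one: "a \<in> carrier Q \<Longrightarrow> \<phi> a \<one>\<^bsub>H\<^esub> = \<one>\<^bsub>H\<^esub>"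
  using act_mult[of a "\<one>\<^bsub>H\<^esub>" "\<one>\<^bsub>H\<^esub>"] act_closed[of a "\<one>\<^bsub>H\<^esub>"] by simp

lemma one_act:
  assumes "x \<in> carrier H"
  shows "\<phi> \<one>\<^bsub>Q\<^esub> x = x"
proof -
  interpret group_hom Q "AutoGroup H" \<phi>
    using hom H.AutoGroup Q.group_axioms by (simp add: group_hom_def group_hom_axioms_def)
  show ?thesis using hom_one assms by (simp add: AutoGroup_def BijGroup_def)
qed

lemma group_hom_left: "group_hom H G (\<lambda>h. (h, \<one>\<^bsub>Q\<^esub>))"
  using H.group_axioms G.group_axioms
  by (auto simp: group_hom_def group_hom_axioms_def hom_def one_act)

lemma group_hom_right: "group_hom Q G (\<lambda>a. (\<one>\<^bsub>H\<^esub>, a))"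
  using Q.group_axioms G.group_axioms
  by (auto simp: group_hom_def group_hom_axioms_def hom_def act_one)

lemma group_hom_snd: "group_hom G Q snd"
  using Q.group_axioms G.group_axioms
  by (auto simp: group_hom_def group_hom_axioms_def hom_def)

section \<open>Intersections with the factors \<open>H\<close> and \<open>Q\<close>\<close>

text \<open>The trace of \<open>K\<close> on the normal factor, taken inside \<open>H\<close> so
  that the hypotheses on subgroups of \<open>H\<close> apply to it.\<close>

definition left_part :: "('a \<times> 'q) set \<Rightarrow> 'a set" where
  "left_part K = {h \<in> carrier H. (h, \<one>\<^bsub>Q\<^esub>) \<in> K}"

definition right_part :: "('a \<times> 'q) set \<Rightarrow> 'q set" where
  "right_part K = {a \<in> carrier Q. (\<one>\<^bsub>H\<^esub>, a) \<in> K}"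

lemma continuous_map_left: "continuous_map T P (\<lambda>h. (h, \<one>\<^bsub>Q\<^esub>))"
  by (intro continuous_map_pairedI continuous_map_id[unfolded id_def])
    (simp add: topspace_S)

lemma continuous_map_right: "continuous_map S P (\<lambda>a. (\<one>\<^bsub>H\<^esub>, a))"
  by (intro continuous_map_pairedI continuous_map_id[unfolded id_def])
    (simp add: H.topspace_eq)

lemma closedin_left_part: "closedin P K \<Longrightarrow> closedin T (left_part K)"
  using closedin_continuous_map_preimage[OF continuous_map_left, of K]
  by (simp add: left_part_def H.topspace_eq)

lemma closedin_right_part: "closedin P K \<Longrightarrow> closedin S (right_part K)"
  using closedin_continuous_map_preimage[OF continuous_map_right, of K]
  by (simp add: right_part_def topspace_S)

lemma left_part:
  assumes "closed_subgroup K G P" "finite_index K G"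
  shows "closed_subgroup (left_part K) H T" "finite_index (left_part K) H"
proof -
  interpret group_hom H G "\<lambda>h. (h, \<one>\<^bsub>Q\<^esub>)" by (rule group_hom_left)
  show "closed_subgroup (left_part K) H T"
    using assms closedin_left_part subgroup_preimage by (simp add: closed_subgroup_def left_part_def)
  show "finite_index (left_part K) H"
    unfolding left_part_def using assms finite_index_preimage by (simp add: closed_subgroup_def)
qed

lemma right_part:
  assumes "closed_subgroup K G P" "finite_index K G"
  shows "closed_subgroup (right_part K) Q S" "finite_index (right_part K) Q"
proof -
  interpret group_hom Q G "\<lambda>a. (\<one>\<^bsub>H\<^esub>, a)" by (rule group_hom_right)
  show "closed_subgroup (right_part K) Q S"
    using assms closedin_right_part subgroup_preimage by (simp add: closed_subgroup_def right_part_def)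
  show "finite_index (right_part K) Q"
    unfolding right_part_def using assms finite_index_preimage by (simp add: closed_subgroup_def)
qed

lemma just_infinite_part:
  "closed_subgroup M H T \<Longrightarrow> finite_index M H \<Longrightarrow> just_infinite (H\<lparr>carrier := M\<rparr>) (subtopology T M)"
  using hereditarily_just_infinite by (simp add: hereditarily_just_infinite_def)

lemma just_infinite_H: "just_infinite H T"
  using just_infinite_part[of "carrier H"] H.subgroup_self H.finite_index_carrier
    closedin_topspace[of T] subtopology_topspace[of T]
  by (simp add: closed_subgroup_def H.topspace_eq)

lemma centralizer_trivial:
  "closed_subgroup M H T \<Longrightarrow> finite_index M H \<Longrightarrow> H.centralizer M = {\<one>\<^bsub>H\<^esub>}"
  using H.centralizer_finite_index_trivial just_infinite_H Fitting_free by blast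

section \<open>Failure of virtual nilpotency\<close>

text \<open>Nilpotency of \<open>L\<close> passes along the continuous embedding to
  \<open>left_part L\<close>. This group is infinite, so it would have a non-trivial central
  element, contrary to its trivial centralizer.\<close>

lemma not_nilpotent:
  assumes L: "closed_subgroup L G P" "finite_index L G"
  shows "lower_central (G\<lparr>carrier := L\<rparr>) (subtopology P L) (Suc c) \<noteq> {\<one>\<^bsub>G\<^esub>}"
proof
  assume nil: "lower_central (G\<lparr>carrier := L\<rparr>) (subtopology P L) (Suc c) = {\<one>\<^bsub>G\<^esub>}"
  let ?M = "left_part L"
  let ?HM = "H\<lparr>carrier := ?M\<rparr>"
  note M = left_part[OF L]
  have sub: "subgroup L G" "subgroup ?M H" using L(1) M(1) by (auto simp: closed_subgroup_def)
  have LG: "L \<subseteq> carrier G" "?M \<subseteq> carrier H" using sub subgroup.subset by blast+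
  have tops: "topspace (subtopology T ?M) = carrier ?HM"
    "topspace (subtopology P L) = carrier (G\<lparr>carrier := L\<rparr>)"
    using LG H.topspace_eq topspace_P by (auto simp: topspace_subtopology)
  interpret HM: group ?HM using sub(2) H.subgroup_imp_group by blast
  have "group_hom ?HM (G\<lparr>carrier := L\<rparr>) (\<lambda>h. (h, \<one>\<^bsub>Q\<^esub>))"
    by (rule group_hom_restrict[OF group_hom_left sub(2,1)]) (auto simp: left_part_def)
  moreover have "continuous_map (subtopology T ?M) (subtopology P L) (\<lambda>h. (h, \<one>\<^bsub>Q\<^esub>))"
    using continuous_map_from_subtopology[OF continuous_map_left, of ?M]
    by (auto simp: continuous_map_in_subtopology left_part_def)
  ultimately have "(\<lambda>h. (h, \<one>\<^bsub>Q\<^esub>)) ` lower_central ?HM (subtopology T ?M) (Suc c) \<subseteq> {\<one>\<^bsub>G\<^esub>}"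
    using lower_central_image_subset[OF _ tops] nil by blast
  then have "lower_central ?HM (subtopology T ?M) (Suc c) = {\<one>\<^bsub>?HM\<^esub>}"
    using one_mem_lower_central[OF HM.group_axioms tops(1)] by (auto simp: image_subset_iff)
  moreover have "infinite ?M"
    using just_infinite_part[OF M] by (simp add: just_infinite_def)
  then have "carrier ?HM \<noteq> {\<one>\<^bsub>?HM\<^esub>}" by auto
  ultimately obtain z where "z \<in> carrier ?HM" "z \<noteq> \<one>\<^bsub>?HM\<^esub>"
    "\<And>y. y \<in> carrier ?HM \<Longrightarrow> z \<otimes>\<^bsub>?HM\<^esub> y = y \<otimes>\<^bsub>?HM\<^esub> z"
    using lower_central_trivial_imp_central[OF HM.group_axioms tops(1)] by metis
  then have "z \<in> H.centralizer ?M" "z \<noteq> \<one>\<^bsub>H\<^esub>"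
    using LG(2) unfolding H.centralizer_def by auto
  then show False using centralizer_trivial[OF M] by blast
qed

lemma not_virtually_nilpotent:
  assumes K: "closed_subgroup K G P" "finite_index K G"
  shows "\<not> virtually_nilpotent c (G\<lparr>carrier := K\<rparr>) (subtopology P K)"
proof
  assume "virtually_nilpotent c (G\<lparr>carrier := K\<rparr>) (subtopology P K)"
  then obtain L where L: "closed_subgroup L (G\<lparr>carrier := K\<rparr>) (subtopology P K)"
    "finite_index L (G\<lparr>carrier := K\<rparr>)"
    and nil: "lower_central (G\<lparr>carrier := K\<rparr>\<lparr>carrier := L\<rparr>) (subtopology (subtopology P K) L) (c + 1)
      = {\<one>\<^bsub>G\<lparr>carrier := K\<rparr>\<^esub>}"
    unfolding virtually_nilpotent_def by blast
  \<comment> \<open>A closed subgroup of finite index in \<open>K\<close> is one in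
    \<open>G\<close>, and by this inclusion it inherits the same topology from both, so the previous
    lemma excludes it.\<close>
  have "L \<subseteq> K" using L(1) subgroup.subset by (fastforce simp: closed_subgroup_def)
  then have "subtopology (subtopology P K) L = subtopology P L"
    by (simp add: subtopology_subtopology inf.absorb2)
  then have "lower_central (G\<lparr>carrier := L\<rparr>) (subtopology P L) (Suc c) = {\<one>\<^bsub>G\<^esub>}"
    using nil by simp
  moreover have "closed_subgroup L G P"
    using closed_subgroup_trans[OF G.group_axioms K(1) L(1)] .
  moreover have "finite_index L G"
    using G.finite_index_trans[of K L] K L by (simp add: closed_subgroup_def)
  ultimately show False using not_nilpotent by blast
qed

section \<open>Normal subgroups that meet \<open>H\<close> trivially\<close>

lemma normal_trivial_if_left_part_trivial:
  assumes K: "closed_subgroup K G P" "finite_index K G"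
    and N: "N \<lhd> G\<lparr>carrier := K\<rparr>" and triv: "left_part N = {\<one>\<^bsub>H\<^esub>}"
  shows "N = {\<one>\<^bsub>G\<^esub>}"
proof -
  have subK: "subgroup K G" using K(1) by (simp add: closed_subgroup_def)
  interpret K: subgroup K G by (rule subK)
  interpret GK: group "G\<lparr>carrier := K\<rparr>" using subK G.subgroup_imp_group by blast
  interpret N: normal N "G\<lparr>carrier := K\<rparr>" by (rule N)
  have NK: "N \<subseteq> K" using N.subset by simp
  \<comment> \<open>The core is used because the argument conjugates by arbitrary elements of
    \<open>H\<close>: it is normal in all of \<open>H\<close> and still has trivial
    centralizer.\<close>
  let ?C = "normal_core H (left_part K)"
  note K0 = left_part[OF K]
  have K0': "subgroup (left_part K) H" using K0(1) by (simp add: closed_subgroup_def)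
  have nC: "?C \<lhd> H" using H.normal_normal_core[OF K0'] .
  then have subC: "subgroup ?C H" using normal_imp_subgroup by blast
  have C: "H.centralizer ?C = {\<one>\<^bsub>H\<^esub>}"
    using centralizer_trivial[of ?C] subC H.closedin_normal_core H.finite_index_normal_core[OF K0' K0(2)]
      K0(1) by (simp add: closed_subgroup_def)
  have CK: "?C \<subseteq> left_part K" using H.normal_core_subset[OF subgroup.subset[OF K0']] .
  have "n = \<one>\<^bsub>G\<^esub>" if "n \<in> N" for n
  proof -
    obtain h a where n: "n = (h, a)" by (cases n)
    have ha: "h \<in> carrier H" "a \<in> carrier Q" using that NK K.subset n by auto
    \<comment> \<open>This is conjugation by \<open>n = (h, a)\<close>, restricted to the normal
      factor \<open>H\<close>.\<close>
    define \<beta> where "\<beta> x = h \<otimes>\<^bsub>H\<^esub> \<phi> a x \<otimes>\<^bsub>H\<^esub> inv\<^bsub>H\<^esub> h" for x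
    have \<beta>_closed: "\<beta> x \<in> carrier H" if "x \<in> carrier H" for x
      using that ha act_closed by (simp add: \<beta>_def)
    have \<beta>_mult: "\<beta> (x \<otimes>\<^bsub>H\<^esub> y) = \<beta> x \<otimes>\<^bsub>H\<^esub> \<beta> y" if "x \<in> carrier H" "y \<in> carrier H" for x y
      using that ha act_closed by (simp add: \<beta>_def act_mult H.m_assoc H.inv_mult_cancel)
    have conj: "n \<otimes>\<^bsub>G\<^esub> (x, \<one>\<^bsub>Q\<^esub>) = (\<beta> x, \<one>\<^bsub>Q\<^esub>) \<otimes>\<^bsub>G\<^esub> n" if "x \<in> carrier H" for x
      using that ha act_closed \<beta>_closed by (simp add: n one_act) (simp add: \<beta>_def H.m_assoc)
    have fix_core: "\<beta> y = y" if y: "y \<in> left_part K" for y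
    proof -
      have yH: "y \<in> carrier H" and yK: "(y, \<one>\<^bsub>Q\<^esub>) \<in> K" using y by (auto simp: left_part_def)
      let ?y = "(y, \<one>\<^bsub>Q\<^esub>)"
      have nK: "n \<in> K" using that NK \<open>n \<in> N\<close> by blast
      have cl: "n \<in> carrier G" "?y \<in> carrier G" "(\<beta> y, \<one>\<^bsub>Q\<^esub>) \<in> carrier G"
        using ha yH n \<beta>_closed by auto
      \<comment> \<open>The commutator of \<open>n\<close> and \<open>?y\<close> lies in
        \<open>N\<close> by normality and in \<open>H\<close> because \<beta> preserves
        \<open>H\<close>; so it is trivial.\<close>
      have "?y \<otimes>\<^bsub>G\<^esub> inv\<^bsub>G\<^esub> n \<otimes>\<^bsub>G\<^esub> inv\<^bsub>G\<^esub> ?y \<in> N"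
        using N.inv_op_closed2[of ?y "inv\<^bsub>G\<^esub> n"] N.m_inv_closed[OF \<open>n \<in> N\<close>] yK nK
        by (simp add: G.m_inv_consistent[OF subK])
      then have "n \<otimes>\<^bsub>G\<^esub> (?y \<otimes>\<^bsub>G\<^esub> inv\<^bsub>G\<^esub> n \<otimes>\<^bsub>G\<^esub> inv\<^bsub>G\<^esub> ?y) \<in> N"
        using N.m_closed[OF \<open>n \<in> N\<close>] by simp
      also have "n \<otimes>\<^bsub>G\<^esub> (?y \<otimes>\<^bsub>G\<^esub> inv\<^bsub>G\<^esub> n \<otimes>\<^bsub>G\<^esub> inv\<^bsub>G\<^esub> ?y) = (n \<otimes>\<^bsub>G\<^esub> ?y) \<otimes>\<^bsub>G\<^esub> inv\<^bsub>G\<^esub> n \<otimes>\<^bsub>G\<^esub> inv\<^bsub>G\<^esub> ?y"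
        using cl by (simp only: G.m_assoc G.inv_closed G.m_closed)
      also have "\<dots> = (\<beta> y, \<one>\<^bsub>Q\<^esub>) \<otimes>\<^bsub>G\<^esub> inv\<^bsub>G\<^esub> ?y"
        unfolding conj[OF yH] using cl by (simp only: G.m_assoc G.inv_closed G.m_closed G.r_inv G.r_one)
      also have "inv\<^bsub>G\<^esub> ?y = (inv\<^bsub>H\<^esub> y, \<one>\<^bsub>Q\<^esub>)"
        using group_hom.hom_inv[OF group_hom_left yH] by simp
      also have "(\<beta> y, \<one>\<^bsub>Q\<^esub>) \<otimes>\<^bsub>G\<^esub> (inv\<^bsub>H\<^esub> y, \<one>\<^bsub>Q\<^esub>) = (\<beta> y \<otimes>\<^bsub>H\<^esub> inv\<^bsub>H\<^esub> y, \<one>\<^bsub>Q\<^esub>)"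
        using yH by (simp add: one_act)
      finally have "\<beta> y \<otimes>\<^bsub>H\<^esub> inv\<^bsub>H\<^esub> y \<in> left_part N"
        using yH \<beta>_closed by (simp add: left_part_def)
      then have "\<beta> y \<otimes>\<^bsub>H\<^esub> inv\<^bsub>H\<^esub> y = \<one>\<^bsub>H\<^esub>" using triv by blast
      then show ?thesis using yH \<beta>_closed[OF yH] by (simp add: H.inv_solve_right')
    qed
    have fix_all: "\<beta> x = x" if x: "x \<in> carrier H" for x
    proof -
      \<comment> \<open>Both \<open>y\<close> and \<open>?z\<close>, its conjugate by
        \<open>x\<close>, lie in the core and are fixed by \<beta>. Applying \<beta> to the two
        sides of \<open>?z x = x y\<close> shows that \<open>x\<close> and \<beta>(x) conjugate
        \<open>y\<close> in the same way.\<close>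
      have "inv\<^bsub>H\<^esub> x \<otimes>\<^bsub>H\<^esub> \<beta> x \<otimes>\<^bsub>H\<^esub> y = y \<otimes>\<^bsub>H\<^esub> (inv\<^bsub>H\<^esub> x \<otimes>\<^bsub>H\<^esub> \<beta> x)" if y: "y \<in> ?C" for y
      proof -
        have yH: "y \<in> carrier H" using y by (simp add: normal_core_def)
        let ?z = "x \<otimes>\<^bsub>H\<^esub> y \<otimes>\<^bsub>H\<^esub> inv\<^bsub>H\<^esub> x"
        have z: "?z \<in> ?C" using nC x y by (simp add: normal.inv_op_closed2)
        have "?z \<otimes>\<^bsub>H\<^esub> \<beta> x = \<beta> ?z \<otimes>\<^bsub>H\<^esub> \<beta> x" using fix_core z CK by (simp add: subset_iff)
        also have "\<dots> = \<beta> (?z \<otimes>\<^bsub>H\<^esub> x)" using x yH by (simp add: \<beta>_mult)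
        also have "?z \<otimes>\<^bsub>H\<^esub> x = x \<otimes>\<^bsub>H\<^esub> y" using x yH by (simp add: H.m_assoc)
        also have "\<beta> (x \<otimes>\<^bsub>H\<^esub> y) = \<beta> x \<otimes>\<^bsub>H\<^esub> y" using x yH fix_core y CK by (simp add: \<beta>_mult subset_iff)
        finally have "\<beta> x \<otimes>\<^bsub>H\<^esub> y = x \<otimes>\<^bsub>H\<^esub> (y \<otimes>\<^bsub>H\<^esub> (inv\<^bsub>H\<^esub> x \<otimes>\<^bsub>H\<^esub> \<beta> x))"
          using x yH \<beta>_closed[OF x] by (simp add: H.m_assoc)
        then show ?thesis using x yH \<beta>_closed[OF x] by (simp add: H.m_assoc H.inv_mult_cancel)
      qed
      then have "inv\<^bsub>H\<^esub> x \<otimes>\<^bsub>H\<^esub> \<beta> x \<in> H.centralizer ?C"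
        using x \<beta>_closed[OF x] by (simp add: H.centralizer_def)
      then have "inv\<^bsub>H\<^esub> x \<otimes>\<^bsub>H\<^esub> \<beta> x = \<one>\<^bsub>H\<^esub>" using C by simp
      then show ?thesis using x \<beta>_closed[OF x] by (simp add: H.inv_solve_left')
    qed
    \<comment> \<open>With \<open>a\<close> trivial, \<beta> is conjugation by \<open>h\<close>; as
      it fixes everything, \<open>h\<close> is central in \<open>H\<close>.\<close>
    have a: "a = \<one>\<^bsub>Q\<^esub>" using outer[OF ha(2,1)] fix_all by (simp add: \<beta>_def)
    have "h \<otimes>\<^bsub>H\<^esub> x = x \<otimes>\<^bsub>H\<^esub> h" if x: "x \<in> carrier H" for x
      using fix_all[OF x] x ha by (simp add: \<beta>_def a one_act H.inv_solve_right')
    then have "h \<in> H.centralizer ?C"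
      using ha by (simp add: H.centralizer_def normal_core_def)
    then show ?thesis using C a n by simp
  qed
  moreover have "\<one>\<^bsub>G\<^esub> \<in> N" using N.one_closed by simp
  ultimately show ?thesis by blast
qed

section \<open>Quotients by normal subgroups that meet \<open>H\<close> in finite index\<close>

lemma virtually_nilpotent_quotient:
  assumes K: "closed_subgroup K G P" "finite_index K G"
    and N: "closed_normal N (G\<lparr>carrier := K\<rparr>) (subtopology P K)"
    and M: "finite_index (left_part N) H"
    and B: "closed_subgroup B Q S" "finite_index B Q"
      "lower_central (Q\<lparr>carrier := B\<rparr>) (subtopology S B) (Suc c) = {\<one>\<^bsub>Q\<^esub>}"
  shows "virtually_nilpotent c (G\<lparr>carrier := K\<rparr> Mod N)
    (quot_topology (G\<lparr>carrier := K\<rparr>) (subtopology P K) N)"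
proof -
  let ?GK = "G\<lparr>carrier := K\<rparr>"
  let ?TK = "subtopology P K"
  let ?F = "?GK Mod N"
  have subK: "subgroup K G" and clK: "closedin P K" using K(1) by (auto simp: closed_subgroup_def)
  have nN: "N \<lhd> ?GK" and clN: "closedin P N"
    using N clK by (auto simp: closed_normal_def closedin_closed_subtopology)
  interpret K: subgroup K G by (rule subK)
  interpret GK: group ?GK using subK G.subgroup_imp_group by blast
  interpret N: normal N ?GK by (rule nN)
  interpret F: group ?F by (rule N.factorgroup_is_group)
  have NK: "N \<subseteq> K" using N.subset by simp
  have subN: "subgroup N G" using G.incl_subgroup[OF subK N.subgroup_axioms] .
  have subM: "subgroup (left_part N) H"
    unfolding left_part_def by (rule group_hom.subgroup_preimage[OF group_hom_left subN])
  have KG: "K \<subseteq> carrier G" by (rule K.subset)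
  have tops: "topspace ?TK = carrier ?GK" using KG topspace_P by (auto simp: topspace_subtopology)
  \<comment> \<open>Only the part of \<open>B\<close> lying in \<open>K\<close> maps to the quotient
    of \<open>K\<close>; it keeps finite index in \<open>Q\<close>.\<close>
  define B' where "B' = B \<inter> right_part K"
  note R = right_part[OF K]
  have subB: "subgroup B Q" and subB': "subgroup B' Q" and clB': "closedin S B'"
    using B(1) R(1) Q.subgroups_Inter_pair by (auto simp: closed_subgroup_def B'_def closedin_Int)
  have fiB': "finite_index B' Q"
    using Q.finite_index_Int B R by (simp add: closed_subgroup_def B'_def)
  interpret B': subgroup B' Q by (rule subB')
  have B'K: "(\<one>\<^bsub>H\<^esub>, b) \<in> K" if "b \<in> B'" for b
    using that unfolding B'_def right_part_def by blast
  have topB: "topspace (subtopology S B) = carrier (Q\<lparr>carrier := B\<rparr>)"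
    and topB': "topspace (subtopology S B') = carrier (Q\<lparr>carrier := B'\<rparr>)"
    using subgroup.subset[OF subB] B'.subset
    by (simp_all add: topspace_subtopology topspace_S inf.absorb2)
  define q where "q b = N #>\<^bsub>?GK\<^esub> (\<one>\<^bsub>H\<^esub>, b)" for b
  \<comment> \<open>The image of \<open>B'\<close> in the quotient, which will witness virtual
    nilpotency.\<close>
  define W where "W = q ` B'"
  have homq: "group_hom ?GK ?F (\<lambda>k. N #>\<^bsub>?GK\<^esub> k)"
    using N.r_coset_hom_Mod GK.group_axioms F.group_axioms
    by (simp add: group_hom_def group_hom_axioms_def)
  have hom_right': "group_hom (Q\<lparr>carrier := B'\<rparr>) ?GK (\<lambda>a. (\<one>\<^bsub>H\<^esub>, a))"
    by (rule group_hom_restrict[OF group_hom_right subB' subK]) (use B'K in auto)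
  have q_hom: "group_hom (Q\<lparr>carrier := B'\<rparr>) ?F q"
    using Group.hom_compose[OF group_hom.homh[OF hom_right'] group_hom.homh[OF homq]]
      group_hom.axioms(1)[OF hom_right'] F.group_axioms
    by (simp add: group_hom_def group_hom_axioms_def q_def[abs_def] o_def)
  have subW: "subgroup W ?F" unfolding W_def using group_hom.img_is_subgroup[OF q_hom] by simp
  have q_eq: "N #>\<^bsub>?GK\<^esub> k = q b \<longleftrightarrow> k \<in> (\<lambda>(g, a). (g, a \<otimes>\<^bsub>Q\<^esub> b)) ` N"
    if "k \<in> K" "b \<in> B'" for k b
  proof -
    have k: "k \<in> carrier ?GK" and b: "(\<one>\<^bsub>H\<^esub>, b) \<in> carrier ?GK"
      using that B'K by simp_all
    have "N #>\<^bsub>?GK\<^esub> k = q b \<longleftrightarrow> k \<in> q b"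
      unfolding q_def using GK.repr_independence[OF _ b N.subgroup_axioms, of k]
        GK.rcos_self[OF k N.subgroup_axioms] by metis
    moreover have "q b = (\<lambda>n. n \<otimes>\<^bsub>G\<^esub> (\<one>\<^bsub>H\<^esub>, b)) ` N"
      by (simp add: q_def r_coset_def UNION_singleton_eq_range)
    moreover have "(\<lambda>n. n \<otimes>\<^bsub>G\<^esub> (\<one>\<^bsub>H\<^esub>, b)) ` N = (\<lambda>(g, a). (g, a \<otimes>\<^bsub>Q\<^esub> b)) ` N"
    proof (rule image_cong[OF refl])
      fix n assume "n \<in> N"
      then have "n \<in> carrier G" using NK KG by blast
      then show "n \<otimes>\<^bsub>G\<^esub> (\<one>\<^bsub>H\<^esub>, b) = (case n of (g, a) \<Rightarrow> (g, a \<otimes>\<^bsub>Q\<^esub> b))"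
        by (cases n) (simp add: act_one)
    qed
    ultimately show ?thesis by (simp only:)
  qed
  have q_closed: "closedin (quot_topology ?GK ?TK N) (q ` X)" if X: "closedin (subtopology S B') X" for X
  proof -
    have XB: "X \<subseteq> B'" and clX: "closedin S X"
      using X clB' by (auto simp: closedin_closed_subtopology)
    \<comment> \<open>The preimage in \<open>K\<close> of the image of \<open>X\<close> is the
      product of \<open>N\<close> and \<open>X\<close>, which is closed. So \<open>q\<close> is a
      closed map, which serves both for closedness of \<open>W\<close> and for its lower central
      series.\<close>
    have LR: "{k \<in> topspace ?TK. N #>\<^bsub>?GK\<^esub> k \<in> q ` X} = (\<lambda>((g, a), b). (g, a \<otimes>\<^bsub>Q\<^esub> b)) ` (N \<times> X)"
      (is "?L = ?R")
    proof (intro equalityI subsetI)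
      fix k assume "k \<in> ?L"
      then obtain x where x: "k \<in> K" "x \<in> X" "N #>\<^bsub>?GK\<^esub> k = q x" using tops by auto
      then have "k \<in> (\<lambda>(g, a). (g, a \<otimes>\<^bsub>Q\<^esub> x)) ` N" using q_eq XB by blast
      then show "k \<in> ?R" using x(2) by force
    next
      fix k assume "k \<in> ?R"
      then obtain g a x where x: "(g, a) \<in> N" "x \<in> X" "k = (g, a \<otimes>\<^bsub>Q\<^esub> x)" by auto
      have "(g, a) \<otimes>\<^bsub>G\<^esub> (\<one>\<^bsub>H\<^esub>, x) \<in> K" using x NK XB B'K by blast
      moreover have "a \<in> carrier Q" "g \<in> carrier H" using x(1) NK KG by auto
      ultimately have "k \<in> K" using x(3) by (simp add: act_one)
      moreover have "k \<in> (\<lambda>(g, a). (g, a \<otimes>\<^bsub>Q\<^esub> x)) ` N" using x by force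
      ultimately have "N #>\<^bsub>?GK\<^esub> k = q x" using q_eq x(2) XB by blast
      with \<open>k \<in> K\<close> show "k \<in> ?L" using x(2) tops by simp
    qed
    have "closedin P ?L" unfolding LR by (rule closedin_translates[OF clN clX])
    moreover have "?L \<subseteq> K" unfolding tops by auto
    ultimately have "closedin ?TK ?L" by (rule closedin_subset_topspace)
    moreover have "q ` X \<subseteq> carrier ?F" using XB group_hom.hom_closed[OF q_hom] by auto
    ultimately show ?thesis unfolding closedin_quot_topology[OF tops] by blast
  qed
  have clW: "closedin (quot_topology ?GK ?TK N) W"
    unfolding W_def by (rule q_closed[OF closedin_subset_topspace[OF clB' subset_refl]])
  then have "closed_subgroup W ?F (quot_topology ?GK ?TK N)"
    using subW by (simp only: closed_subgroup_def simp_thms)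
  \<comment> \<open>The coset map is surjective, so it suffices that the preimage of
    \<open>W\<close> has finite index in \<open>K\<close>.\<close>
  moreover have "finite_index W ?F"
  proof (rule group_hom.finite_index_image[OF homq _ subW])
    show "(\<lambda>k. N #>\<^bsub>?GK\<^esub> k) ` carrier ?GK = carrier ?F" by (simp add: carrier_FactGroup)
    interpret sn: group_hom G Q snd by (rule group_hom_snd)
    interpret ri: group_hom Q G "\<lambda>a. (\<one>\<^bsub>H\<^esub>, a)" by (rule group_hom_right)
    interpret le: group_hom H G "\<lambda>h. (h, \<one>\<^bsub>Q\<^esub>)" by (rule group_hom_left)
    \<comment> \<open>Every \<open>k \<in> K\<close> factors as \<open>b k \<cdot> m k \<cdot> s k\<close> with \<open>b k \<in> B'\<close>, \<open>m k \<in> H\<close> and \<open>s k\<close> from a finite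
      set; \<open>k\<close> modulo \<open>N B'\<close> depends only on \<open>s k\<close> and on \<open>m k\<close> modulo \<open>N \<inter> H\<close>.\<close>
    define t where "t C = (SOME l. l \<in> K \<and> B' #>\<^bsub>Q\<^esub> snd l = C)" for C
    define s where "s k = t (B' #>\<^bsub>Q\<^esub> snd k)" for k :: "'a \<times> 'q"
    define b where "b k = snd k \<otimes>\<^bsub>Q\<^esub> inv\<^bsub>Q\<^esub> snd (s k)" for k
    define m where "m k = (\<one>\<^bsub>H\<^esub>, inv\<^bsub>Q\<^esub> b k) \<otimes>\<^bsub>G\<^esub> k \<otimes>\<^bsub>G\<^esub> inv\<^bsub>G\<^esub> s k" for k
    have s: "s k \<in> K" "b k \<in> B'" if k: "k \<in> K" for k
    proof -
      have *: "s k \<in> K \<and> B' #>\<^bsub>Q\<^esub> snd (s k) = B' #>\<^bsub>Q\<^esub> snd k"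
        unfolding s_def t_def by (rule someI[of _ k]) (use k in auto)
      then show "s k \<in> K" by blast
      then have "snd k \<in> carrier Q" "snd (s k) \<in> carrier Q"
        using k KG sn.hom_closed by blast+
      then show "b k \<in> B'"
        unfolding b_def using rcos_eq_imp_div_mem[OF Q.group_axioms subB' _ _ conjunct2[OF *, symmetric]]
        by blast
    qed
    have cl: "k \<in> carrier G" "s k \<in> carrier G" "b k \<in> carrier Q"
      "(\<one>\<^bsub>H\<^esub>, b k) \<in> carrier G" "(\<one>\<^bsub>H\<^esub>, inv\<^bsub>Q\<^esub> b k) \<in> carrier G" if k: "k \<in> K" for k
    proof -
      show "k \<in> carrier G" "s k \<in> carrier G" using k s(1)[OF k] KG by blast+
      show b: "b k \<in> carrier Q" using s(2)[OF k] B'.subset by blast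
      then show "(\<one>\<^bsub>H\<^esub>, b k) \<in> carrier G" "(\<one>\<^bsub>H\<^esub>, inv\<^bsub>Q\<^esub> b k) \<in> carrier G"
        by (simp_all del: ri.hom_inv)
    qed
    have mG: "m k \<in> carrier G" if k: "k \<in> K" for k
      unfolding m_def by (intro G.m_closed G.inv_closed cl[OF k])
    have m: "fst (m k) \<in> carrier H" "m k = (fst (m k), \<one>\<^bsub>Q\<^esub>)" if k: "k \<in> K" for k
    proof -
      note cl = cl[OF k]
      have cl': "snd k \<in> carrier Q" "snd (s k) \<in> carrier Q"
        using cl(1,2) sn.hom_closed by blast+
      have "snd (m k) = inv\<^bsub>Q\<^esub> b k \<otimes>\<^bsub>Q\<^esub> snd k \<otimes>\<^bsub>Q\<^esub> inv\<^bsub>Q\<^esub> snd (s k)"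
        unfolding m_def using cl
        by (simp only: sn.hom_mult sn.hom_inv G.m_closed G.inv_closed snd_conv)
      also have "\<dots> = inv\<^bsub>Q\<^esub> b k \<otimes>\<^bsub>Q\<^esub> b k"
        using cl(3) cl' by (simp only: b_def Q.m_assoc Q.inv_closed Q.m_closed)
      also have "\<dots> = \<one>\<^bsub>Q\<^esub>" using cl(3) by (rule Q.l_inv)
      finally have "snd (m k) = \<one>\<^bsub>Q\<^esub>" .
      then show "fst (m k) \<in> carrier H" "m k = (fst (m k), \<one>\<^bsub>Q\<^esub>)"
        using mG[OF k] by (cases "m k"; simp)+
    qed
    have k_eq: "k = (\<one>\<^bsub>H\<^esub>, b k) \<otimes>\<^bsub>G\<^esub> m k \<otimes>\<^bsub>G\<^esub> s k" if k: "k \<in> K" for k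
    proof -
      have "(\<one>\<^bsub>H\<^esub>, inv\<^bsub>Q\<^esub> b k) = inv\<^bsub>G\<^esub> (\<one>\<^bsub>H\<^esub>, b k)" using ri.hom_inv[OF cl(3)[OF k]] .
      then show ?thesis
        unfolding m_def using cl(1,2,4)[OF k]
        by (simp only: G.m_assoc G.inv_mult_cancel G.l_inv G.r_one G.m_closed G.inv_closed)
    qed
    show "finite_index {k \<in> carrier ?GK. N #>\<^bsub>?GK\<^esub> k \<in> W} ?GK"
    proof (rule finite_indexI[OF GK.group_axioms group_hom.subgroup_preimage[OF homq subW],
          where f = "\<lambda>k. (s k, left_part N #>\<^bsub>H\<^esub> fst (m k))"])
      let ?f = "\<lambda>k. (s k, left_part N #>\<^bsub>H\<^esub> fst (m k))"
      have "s ` K \<subseteq> t ` ((\<lambda>x. B' #>\<^bsub>Q\<^esub> x) ` carrier Q)"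
        using cl(1) sn.hom_closed unfolding s_def by blast
      then have "finite (s ` K)" using finite_index_finite_image[OF fiB'] finite_subset by blast
      then have "finite (s ` K \<times> (\<lambda>x. left_part N #>\<^bsub>H\<^esub> x) ` carrier H)"
        using finite_index_finite_image[OF M] by (rule finite_cartesian_product)
      moreover have "?f ` K \<subseteq> s ` K \<times> (\<lambda>x. left_part N #>\<^bsub>H\<^esub> x) ` carrier H"
        using m(1) by blast
      ultimately have "finite (?f ` K)" by (rule finite_subset[rotated])
      then show "finite (?f ` carrier ?GK)" by simp
      fix k l assume kl': "k \<in> carrier ?GK" "l \<in> carrier ?GK" and eq: "?f k = ?f l"
      have kl: "k \<in> K" "l \<in> K" using kl' by simp_all
      have sl: "s l = s k" and ml: "left_part N #>\<^bsub>H\<^esub> fst (m k) = left_part N #>\<^bsub>H\<^esub> fst (m l)"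
        using eq by (metis prod.inject)+
      have mult_GK: "mult ?GK = mult G" by simp
      let ?i = "\<lambda>b. (\<one>\<^bsub>H\<^esub>, b)"
      let ?m = "m k \<otimes>\<^bsub>G\<^esub> inv\<^bsub>G\<^esub> m l"
      have "fst (m k) \<otimes>\<^bsub>H\<^esub> inv\<^bsub>H\<^esub> fst (m l) \<in> left_part N"
        using rcos_eq_imp_div_mem[OF H.group_axioms subM m(1)[OF kl(1)] m(1)[OF kl(2)] ml] .
      then have "(fst (m k) \<otimes>\<^bsub>H\<^esub> inv\<^bsub>H\<^esub> fst (m l), \<one>\<^bsub>Q\<^esub>) \<in> N"
        unfolding left_part_def by blast
      moreover have "(fst (m k) \<otimes>\<^bsub>H\<^esub> inv\<^bsub>H\<^esub> fst (m l), \<one>\<^bsub>Q\<^esub>) =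
          (fst (m k), \<one>\<^bsub>Q\<^esub>) \<otimes>\<^bsub>G\<^esub> inv\<^bsub>G\<^esub> (fst (m l), \<one>\<^bsub>Q\<^esub>)"
        using m(1)[OF kl(1)] m(1)[OF kl(2)] by (simp only: le.hom_mult le.hom_inv H.inv_closed)
      ultimately have mN: "?m \<in> N"
        using m(2)[OF kl(1)] m(2)[OF kl(2)] by argo
      have bK: "?i (b k) \<in> K" "?i (b l) \<in> K" using s(2) kl B'K by blast+
      let ?n = "?i (b k) \<otimes>\<^bsub>G\<^esub> ?m \<otimes>\<^bsub>G\<^esub> inv\<^bsub>G\<^esub> ?i (b k)"
      have "?i (b k) \<otimes>\<^bsub>?GK\<^esub> ?m \<otimes>\<^bsub>?GK\<^esub> inv\<^bsub>?GK\<^esub> ?i (b k) \<in> N"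
        by (rule N.inv_op_closed2[OF _ mN]) (simp add: bK)
      then have nN': "?n \<in> N" by (simp only: G.m_inv_consistent[OF subK bK(1)] mult_GK)
      \<comment> \<open>The common factor \<open>s k\<close> cancels. What remains is
        \<open>?n\<close>, a conjugate of \<open>?m\<close> by an element of \<open>K\<close> and
        hence in \<open>N\<close>, times an element of \<open>B'\<close>.\<close>
      have "k \<otimes>\<^bsub>G\<^esub> inv\<^bsub>G\<^esub> l = (?i (b k) \<otimes>\<^bsub>G\<^esub> m k \<otimes>\<^bsub>G\<^esub> s k) \<otimes>\<^bsub>G\<^esub> inv\<^bsub>G\<^esub> (?i (b l) \<otimes>\<^bsub>G\<^esub> m l \<otimes>\<^bsub>G\<^esub> s k)"
        using k_eq[OF kl(1)] k_eq[OF kl(2)] unfolding sl by argo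
      also have "\<dots> = ?n \<otimes>\<^bsub>G\<^esub> (?i (b k) \<otimes>\<^bsub>G\<^esub> inv\<^bsub>G\<^esub> ?i (b l))"
        using cl(2,4)[OF kl(1)] cl(4)[OF kl(2)] mG[OF kl(1)] mG[OF kl(2)]
        by (simp only: G.m_assoc G.inv_mult_group G.inv_mult_cancel G.m_closed G.inv_closed)
      also have "?i (b k) \<otimes>\<^bsub>G\<^esub> inv\<^bsub>G\<^esub> ?i (b l) = ?i (b k \<otimes>\<^bsub>Q\<^esub> inv\<^bsub>Q\<^esub> b l)"
        using cl(3)[OF kl(1)] cl(3)[OF kl(2)] by (simp only: ri.hom_mult ri.hom_inv Q.inv_closed)
      finally have "k \<otimes>\<^bsub>G\<^esub> inv\<^bsub>G\<^esub> l = ?n \<otimes>\<^bsub>G\<^esub> ?i (b k \<otimes>\<^bsub>Q\<^esub> inv\<^bsub>Q\<^esub> b l)" .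
      then have kq: "k \<otimes>\<^bsub>G\<^esub> inv\<^bsub>G\<^esub> l \<in> N #>\<^bsub>?GK\<^esub> ?i (b k \<otimes>\<^bsub>Q\<^esub> inv\<^bsub>Q\<^esub> b l)"
        using nN' unfolding r_coset_def by (auto simp del: mult_G)
      have bb: "b k \<otimes>\<^bsub>Q\<^esub> inv\<^bsub>Q\<^esub> b l \<in> B'" using s(2) kl by simp
      have "?i (b k \<otimes>\<^bsub>Q\<^esub> inv\<^bsub>Q\<^esub> b l) \<in> carrier ?GK" using B'K[OF bb] by simp
      then have "q (b k \<otimes>\<^bsub>Q\<^esub> inv\<^bsub>Q\<^esub> b l) = N #>\<^bsub>?GK\<^esub> (k \<otimes>\<^bsub>G\<^esub> inv\<^bsub>G\<^esub> l)"
        unfolding q_def by (rule GK.repr_independence[OF kq _ N.subgroup_axioms])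
      then have "N #>\<^bsub>?GK\<^esub> (k \<otimes>\<^bsub>G\<^esub> inv\<^bsub>G\<^esub> l) \<in> W" unfolding W_def using bb by blast
      moreover have "k \<otimes>\<^bsub>G\<^esub> inv\<^bsub>G\<^esub> l \<in> K" using kl by simp
      moreover have "k \<otimes>\<^bsub>?GK\<^esub> inv\<^bsub>?GK\<^esub> l = k \<otimes>\<^bsub>G\<^esub> inv\<^bsub>G\<^esub> l"
        by (simp only: G.m_inv_consistent[OF subK kl(2)] mult_GK)
      ultimately show "k \<otimes>\<^bsub>?GK\<^esub> inv\<^bsub>?GK\<^esub> l \<in> {k \<in> carrier ?GK. N #>\<^bsub>?GK\<^esub> k \<in> W}"
        by simp
    qed
  qed
  moreover have "lower_central (?F\<lparr>carrier := W\<rparr>) (subtopology (quot_topology ?GK ?TK N) W) (c + 1)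
      = {\<one>\<^bsub>?F\<^esub>}"
  proof -
    let ?TF = "quot_topology ?GK ?TK N"
    have WF: "W \<subseteq> topspace ?TF" using closedin_subset[OF clW] .
    have topW: "topspace (subtopology ?TF W) = carrier (?F\<lparr>carrier := W\<rparr>)"
      using WF by (auto simp: topspace_subtopology)
    have homW: "group_hom (Q\<lparr>carrier := B'\<rparr>) (?F\<lparr>carrier := W\<rparr>) q"
      using group_hom_restrict[OF q_hom group.subgroup_self[OF group_hom.axioms(1)[OF q_hom]] subW]
      by (simp add: W_def)
    have homB: "group_hom (Q\<lparr>carrier := B'\<rparr>) (Q\<lparr>carrier := B\<rparr>) id"
      by (rule group_hom_restrict[OF _ subB' subB])
        (auto simp: B'_def group_hom_def group_hom_axioms_def hom_def Q.group_axioms)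
    have cont: "continuous_map (subtopology S B') (subtopology S B) id"
      by (auto simp: continuous_map_in_subtopology continuous_map_from_subtopology B'_def)
    \<comment> \<open>The inclusion of \<open>B'\<close> into \<open>B\<close> is a continuous
      homomorphism, so the trivial term of the series of \<open>B\<close> forces that of
      \<open>B'\<close>.\<close>
    have "lower_central (Q\<lparr>carrier := B'\<rparr>) (subtopology S B') (Suc c) \<subseteq> {\<one>\<^bsub>Q\<^esub>}"
      using lower_central_image_subset[OF homB topB' topB cont, of "Suc c"] B(3) by simp
    \<comment> \<open>As \<open>q\<close> is a closed surjection of \<open>B'\<close> onto
      \<open>W\<close>, the class bound \<open>c\<close> carries over unchanged.\<close>
    moreover have "lower_central (?F\<lparr>carrier := W\<rparr>) (subtopology ?TF W) (Suc c)
        \<subseteq> q ` lower_central (Q\<lparr>carrier := B'\<rparr>) (subtopology S B') (Suc c)"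
    proof (rule lower_central_subset_image[OF homW topB' topW])
      show "q ` carrier (Q\<lparr>carrier := B'\<rparr>) = carrier (?F\<lparr>carrier := W\<rparr>)" by (simp add: W_def)
      fix X assume X: "closedin (subtopology S B') X"
      then have "X \<subseteq> B'" using closedin_subset topB' by fastforce
      then show "closedin (subtopology ?TF W) (q ` X)"
        using q_closed[OF X] clW by (auto simp: closedin_closed_subtopology W_def)
    qed
    moreover have "q \<one>\<^bsub>Q\<^esub> = \<one>\<^bsub>?F\<^esub>" using group_hom.hom_one[OF q_hom] by simp
    ultimately have "lower_central (?F\<lparr>carrier := W\<rparr>) (subtopology ?TF W) (Suc c) \<subseteq> {\<one>\<^bsub>?F\<^esub>}"
      by blast
    then show ?thesis
      using one_mem_lower_central[OF group_hom.axioms(2)[OF homW] topW, of "Suc c"] by auto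
  qed
  ultimately show ?thesis unfolding virtually_nilpotent_def by blast
qed

section \<open>The hereditary property of the semidirect product\<close>

theorem hereditarily_JNNF:
  assumes "virtually_nilpotent c Q S"
  shows "hereditarily_JNNF c G P"
  unfolding hereditarily_JNNF_def JNNF_def
proof (intro allI impI conjI; (elim conjE)?)
  fix K assume K: "closed_subgroup K G P" "finite_index K G"
  then show "\<not> virtually_nilpotent c (G\<lparr>carrier := K\<rparr>) (subtopology P K)"
    by (rule not_virtually_nilpotent)
  let ?GK = "G\<lparr>carrier := K\<rparr>"
  fix N assume N: "closed_normal N ?GK (subtopology P K)" and ne: "N \<noteq> {\<one>\<^bsub>?GK\<^esub>}"
  let ?L = "left_part K"
  let ?HL = "H\<lparr>carrier := ?L\<rparr>"
  let ?M = "left_part N"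
  have subK: "subgroup K G" and clK: "closedin P K" using K(1) by (auto simp: closed_subgroup_def)
  have nN: "N \<lhd> ?GK" and clN: "closedin P N"
    using N clK by (auto simp: closed_normal_def closedin_closed_subtopology)
  interpret N: normal N ?GK by (rule nN)
  note L = left_part[OF K]
  have subL: "subgroup ?L H" and clL: "closedin T ?L" using L(1) by (auto simp: closed_subgroup_def)
  interpret hl: group_hom ?HL ?GK "\<lambda>h. (h, \<one>\<^bsub>Q\<^esub>)"
    by (rule group_hom_restrict[OF group_hom_left subL subK]) (auto simp: left_part_def)
  have M_eq: "?M = {h \<in> carrier ?HL. (h, \<one>\<^bsub>Q\<^esub>) \<in> N}"
    using N.subset by (auto simp: left_part_def)
  have subM: "subgroup ?M ?HL" unfolding M_eq by (rule hl.subgroup_preimage[OF N.subgroup_axioms])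
  have "?M \<lhd> ?HL"
  proof (rule hl.G.normal_invI[OF subM])
    fix x h assume xh: "x \<in> carrier ?HL" "h \<in> ?M"
    then have h: "h \<in> carrier ?HL" "(h, \<one>\<^bsub>Q\<^esub>) \<in> N" by (auto simp: M_eq)
    have "(x \<otimes>\<^bsub>?HL\<^esub> h \<otimes>\<^bsub>?HL\<^esub> inv\<^bsub>?HL\<^esub> x, \<one>\<^bsub>Q\<^esub>) =
        (x, \<one>\<^bsub>Q\<^esub>) \<otimes>\<^bsub>?GK\<^esub> (h, \<one>\<^bsub>Q\<^esub>) \<otimes>\<^bsub>?GK\<^esub> inv\<^bsub>?GK\<^esub> (x, \<one>\<^bsub>Q\<^esub>)"
      using xh(1) h(1) by (simp only: hl.hom_mult hl.hom_inv hl.G.m_closed hl.G.inv_closed)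
    then have "(x \<otimes>\<^bsub>?HL\<^esub> h \<otimes>\<^bsub>?HL\<^esub> inv\<^bsub>?HL\<^esub> x, \<one>\<^bsub>Q\<^esub>) \<in> N"
      using N.inv_op_closed2[OF hl.hom_closed[OF xh(1)] h(2)] by simp
    then show "x \<otimes>\<^bsub>?HL\<^esub> h \<otimes>\<^bsub>?HL\<^esub> inv\<^bsub>?HL\<^esub> x \<in> ?M"
      unfolding M_eq using xh(1) h(1) by blast
  qed
  moreover have "closedin (subtopology T ?L) ?M"
    using closedin_left_part[OF clN] clL M_eq by (auto simp: closedin_closed_subtopology)
  moreover have "?M \<noteq> {\<one>\<^bsub>H\<^esub>}"
    using normal_trivial_if_left_part_trivial[OF K nN] ne by auto
  \<comment> \<open>Here the hereditary hypothesis enters: \<open>?M\<close> is known to be normal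
    in \<open>?L\<close> only, so just infiniteness is applied to \<open>?L\<close> in place of
    \<open>H\<close>.\<close>
  ultimately have "finite (carrier (?HL Mod ?M))"
    using just_infinite_part[OF L] by (auto simp: just_infinite_def closed_normal_def)
  then have "finite_index ?M ?HL" by (simp add: finite_index_def FactGroup_def)
  then have "finite_index ?M H" using H.finite_index_trans[OF subL subM L(2)] by blast
  then show "virtually_nilpotent c (?GK Mod N) (quot_topology ?GK (subtopology P K) N)"
    using assms virtually_nilpotent_quotient[OF K N] unfolding virtually_nilpotent_def[of c Q]
    by auto
qed

end

section \<open>Groups of automorphisms\<close>

lemma prod_topology_discrete:
  "prod_topology (discrete_topology U) (discrete_topology V) = discrete_topology (U \<times> V)"
proof (rule sym, unfold discrete_topology_unique, intro conjI ballI)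
  fix x assume "x \<in> U \<times> V"
  then show "openin (prod_topology (discrete_topology U) (discrete_topology V)) {x}"
    using openin_prod_Times_iff[of "discrete_topology U" "discrete_topology V" "{fst x}" "{snd x}"]
    by auto
qed simp

lemma (in group) hausdorff_group_discrete: "hausdorff_group G (discrete_topology (carrier G))"
  by unfold_locales (auto simp: prod_topology_discrete)

lemma profinite_imp_hausdorff_group:
  assumes "profinite_group G T"
  shows "hausdorff_group G T"
  using assms unfolding profinite_group_def top_group_def
  by (simp add: hausdorff_group_def hausdorff_group_axioms_def)

lemma closedin_translates_discrete:
  assumes "group Q" "T = discrete_topology U" "S = discrete_topology (carrier Q)"
    and "closedin (prod_topology T S) N" "closedin S Z"
  shows "closedin (prod_topology T S) ((\<lambda>((g, a), b). (g, a \<otimes>\<^bsub>Q\<^esub> b)) ` (N \<times> Z))"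
proof -
  interpret Q: group Q by fact
  show ?thesis using assms(4,5) by (auto simp: assms(2,3) prod_topology_discrete)
qed

text \<open>The set is the image of the compact set \<open>N \<times> Z\<close> under a continuous
  map into a Hausdorff space.\<close>

lemma closedin_translates_compact:
  assumes "hausdorff_group Q S" "compact_space T" "Hausdorff_space T" "compact_space S"
    and "closedin (prod_topology T S) N" "closedin S Z"
  shows "closedin (prod_topology T S) ((\<lambda>((g, a), b). (g, a \<otimes>\<^bsub>Q\<^esub> b)) ` (N \<times> Z))"
proof -
  interpret Q: hausdorff_group Q S by fact
  let ?X = "prod_topology (prod_topology T S) S"
  have "compactin ?X (N \<times> Z)"
    using assms by (simp add: compactin_Times closedin_compact_space compact_space_prod_topology)
  moreover have "continuous_map ?X (prod_topology T S) (\<lambda>p. (fst (fst p), snd (fst p) \<otimes>\<^bsub>Q\<^esub> snd p))"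
  proof (intro continuous_map_pairedI Q.continuous_map_mult)
    show "continuous_map ?X T (\<lambda>p. fst (fst p))" "continuous_map ?X S (\<lambda>p. snd (fst p))"
      using continuous_map_compose[OF continuous_map_fst continuous_map_fst, of T S S]
        continuous_map_compose[OF continuous_map_fst continuous_map_snd, of T S S]
      by (simp_all only: o_def)
    show "continuous_map ?X S snd" by (rule continuous_map_snd)
  qed
  ultimately have "compactin (prod_topology T S)
      ((\<lambda>p. (fst (fst p), snd (fst p) \<otimes>\<^bsub>Q\<^esub> snd p)) ` (N \<times> Z))"
    by (rule image_compactin)
  then have "closedin (prod_topology T S)
      ((\<lambda>p. (fst (fst p), snd (fst p) \<otimes>\<^bsub>Q\<^esub> snd p)) ` (N \<times> Z))"
    using assms(3) Q.Hausdorff by (intro compactin_imp_closedin) (simp_all add: Hausdorff_space_prod_topology)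
  then show ?thesis by (simp add: case_prod_unfold)
qed

text \<open>If \<open>a\<close> followed by conjugation by \<open>h\<close> is the identity, then
  \<open>a\<close> is conjugation by the inverse of \<open>h\<close>, hence inner. This translates
  the condition on \<open>Inn H\<close> into the hypothesis \<open>outer\<close>.\<close>

lemma twisted_trivial_imp_one:
  assumes "group H" "A \<subseteq> auto H" "A \<inter> Inn H = {\<one>\<^bsub>AutoGroup H\<^esub>}"
    and "a \<in> A" "h \<in> carrier H"
    and fix_all: "\<And>x. x \<in> carrier H \<Longrightarrow> h \<otimes>\<^bsub>H\<^esub> a x \<otimes>\<^bsub>H\<^esub> inv\<^bsub>H\<^esub> h = x"
  shows "a = \<one>\<^bsub>AutoGroup H\<^esub>"
proof -
  interpret H: group H by fact
  have aut: "a \<in> auto H" using assms(2,4) by blast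
  then have ext: "a \<in> extensional (carrier H)" and hm: "a \<in> hom H H"
    by (auto simp: auto_def Bij_def)
  have "a = (\<lambda>x\<in>carrier H. inv\<^bsub>H\<^esub> h \<otimes>\<^bsub>H\<^esub> x \<otimes>\<^bsub>H\<^esub> inv\<^bsub>H\<^esub> (inv\<^bsub>H\<^esub> h))"
  proof (rule extensionalityI[OF ext])
    fix x assume x: "x \<in> carrier H"
    have ax: "a x \<in> carrier H" using hm x by (auto simp: hom_def)
    have "inv\<^bsub>H\<^esub> h \<otimes>\<^bsub>H\<^esub> (h \<otimes>\<^bsub>H\<^esub> a x \<otimes>\<^bsub>H\<^esub> inv\<^bsub>H\<^esub> h) \<otimes>\<^bsub>H\<^esub> h = a x"
      using ax assms(5) by (simp add: H.m_assoc H.inv_mult_cancel)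
    then show "a x = (\<lambda>x\<in>carrier H. inv\<^bsub>H\<^esub> h \<otimes>\<^bsub>H\<^esub> x \<otimes>\<^bsub>H\<^esub> inv\<^bsub>H\<^esub> (inv\<^bsub>H\<^esub> h)) x"
      using fix_all[OF x] x assms(5) by simp
  qed simp
  then have "a \<in> Inn H" unfolding Inn_def using assms(5) by blast
  then show ?thesis using assms(3,4) by blast
qed

theorem theorem6p2:
  fixes H :: "('a, 'b) monoid_scheme" and T :: "'a topology"
    and A :: "('a \<Rightarrow> 'a) set" and S :: "('a \<Rightarrow> 'a) topology" and c :: nat
  assumes "(discrete_group H T \<and> subgroup A (AutoGroup H) \<and> S = discrete_topology A) \<or>
           (profinite_group H T \<and> subgroup A (AutoGroup_c H T)
              \<and> S = subtopology (auto_topology H T) A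
              \<and> profinite_group ((AutoGroup H)\<lparr>carrier := A\<rparr>) S)"
    and "hereditarily_just_infinite H T"
    and "Fitting_free H T"
    and "virtually_nilpotent c ((AutoGroup H)\<lparr>carrier := A\<rparr>) S"
    and "A \<inter> Inn H = {\<one>\<^bsub>AutoGroup H\<^esub>}"
  shows "hereditarily_JNNF c
           (semidirect_product H ((AutoGroup H)\<lparr>carrier := A\<rparr>) (\<lambda>a. a)) (prod_topology T S)"
proof -
  let ?Q = "(AutoGroup H)\<lparr>carrier := A\<rparr>"
  \<comment> \<open>These are the facts through which the discrete and the profinite case enter;
    after them a single argument serves both.\<close>
  have common: "hausdorff_group H T \<and> hausdorff_group ?Q S \<and> A \<subseteq> auto H \<and>
    (\<forall>N Z. closedin (prod_topology T S) N \<longrightarrow> closedin S Z \<longrightarrow>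
      closedin (prod_topology T S) ((\<lambda>((g, a), b). (g, a \<otimes>\<^bsub>?Q\<^esub> b)) ` (N \<times> Z)))"
    using assms(1)
  proof (elim disjE conjE)
    assume H: "discrete_group H T" and A: "subgroup A (AutoGroup H)" and S: "S = discrete_topology A"
    interpret H: group H using H by (simp add: discrete_group_def)
    have T: "T = discrete_topology (carrier H)" using H by (simp add: discrete_group_def)
    have Q: "group ?Q" using A H.AutoGroup group.subgroup_imp_group by blast
    have "A \<subseteq> auto H" using subgroup.subset[OF A] by (simp add: AutoGroup_def)
    moreover have "hausdorff_group ?Q S" using group.hausdorff_group_discrete[OF Q] S by simp
    moreover have "hausdorff_group H T" using H.hausdorff_group_discrete T by simp
    ultimately show ?thesis using closedin_translates_discrete[OF Q T, of S] S by simp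
  next
    assume H: "profinite_group H T" and A: "subgroup A (AutoGroup_c H T)"
      and Q: "profinite_group ?Q S"
    have "A \<subseteq> auto H" using subgroup.subset[OF A] by (auto simp: AutoGroup_c_def auto_c_def)
    moreover have hQ: "hausdorff_group ?Q S" using profinite_imp_hausdorff_group[OF Q] .
    moreover have "hausdorff_group H T" using profinite_imp_hausdorff_group[OF H] .
    moreover have "compact_space T" "Hausdorff_space T" "compact_space S"
      using H Q by (simp_all add: profinite_group_def)
    ultimately show ?thesis using closedin_translates_compact[OF hQ, of T] by simp
  qed
  then have H: "hausdorff_group H T" and Q: "hausdorff_group ?Q S" and A: "A \<subseteq> auto H" by blast+
  interpret H: hausdorff_group H T by (rule H)
  interpret Q: hausdorff_group ?Q S by (rule Q)
  interpret semidirect H T ?Q S "\<lambda>a. a"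
  proof (unfold_locales)
    show "topspace S = carrier ?Q" by (rule Q.topspace_eq)
    show "(\<lambda>a. a) \<in> hom ?Q (AutoGroup H)"
      using A by (auto simp: hom_def AutoGroup_def)
    show "closedin (prod_topology T S) ((\<lambda>((g, a), b). (g, a \<otimes>\<^bsub>?Q\<^esub> b)) ` (N \<times> Z))"
      if "closedin (prod_topology T S) N" "closedin S Z" for N Z
      using common that by blast
    show "a = \<one>\<^bsub>?Q\<^esub>" if "a \<in> carrier ?Q" "h \<in> carrier H"
      "\<And>x. x \<in> carrier H \<Longrightarrow> h \<otimes>\<^bsub>H\<^esub> a x \<otimes>\<^bsub>H\<^esub> inv\<^bsub>H\<^esub> h = x" for a h
      using twisted_trivial_imp_one[OF H.group_axioms A assms(5)] that by simp
  qed (fact assms)+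
  show ?thesis using hereditarily_JNNF[OF assms(4)] .
qed

end
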